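(* Let $M$ be a connected manifold with a Borel measure $d\mu$, let $\Omega$ be a propagator on $(M,d\mu)$ (on a Hermitian line bundle $\mathcal{L}\to M$), and let $x,y\in M$. For each partition $\Delta=\{0=t_0<t_1<\cdots<t_n=1\}$ of $[0,1]$ let $$\Omega_\Delta:M^{n-1}\to\mathrm{Hom}(\mathcal{L}_x,\mathcal{L}_y),\qquad \Omega_\Delta(x_1,\ldots,x_{n-1})=\Omega(x,x_1)\Omega(x_1,x_2)\cdots\Omega(x_{n-1},y).$$ Then $\{((X,\mathcal{B}_\Delta,\Omega_\Delta\,d\mu),\mathds{1})\}_{\Delta\in\Delta_{[0,1]}}$ is an inverse system of $\mathrm{Hom}(\mathcal{L}_x,\mathcal{L}_y)$-valued (i.e., since $\mathrm{Hom}(\mathcal{L}_x,\mathcal{L}_y)\cong\mathbb{C}$, complex) measure spaces, with the identity maps as transition maps, and in the category of measurable spaces $$(X,\mathcal{B})=\varprojlim\,(X,\mathcal{B}_\Delta).$$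
   Context: **Propagators.** Let $\mathcal{L}\to M$ be a complex line bundle with Hermitian metric, $\pi_0,\pi_1:M\times M\to M$ the projections. A section $\Omega$ of $\pi_0^*\mathcal{L}^*\otimes\pi_1^*\mathcal{L}$ assigns to $(x,y)$ a linear map $\Omega(x,y):\mathcal{L}_x\to\mathcal{L}_y$, written as acting on the right, so products compose from left to right. A propagator is a continuous such section with: (1) $\Omega(x,x)=\mathds{1}$; (2) $|\Omega(x,y)|<1$ if $x\ne y$; (3) $\Omega(x,y)=\Omega^*(y,x)$ (the Hermitian adjoint of $\Omega(y,x)$); (4) $\int_M\Omega(x,z)\Omega(z,y)\,d\mu(z)=\Omega(x,y)$; (5) $\sup_{x\in M}\int_M|\Omega(x,y)|\,d\mu(y)<\infty$. **Path space.** $X=\{\gamma:[0,1]\to M:\gamma(0)=x,\ \gamma(1)=y\}$ is the space of continuous paths from $x$ to $y$ with the compact-open topology, and $\mathcal{B}$ is its Borel $\sigma$-algebra. $\Delta_{[0,1]}$ is the directed set of finite partitions of $[0,1]$, ordered by refinement. For $\Delta\in\Delta_{[0,1]}$, $\mathcal{B}_\Delta$ consists of those $A\in\mathcal{B}$ such that $\gamma_1\in A$ and $\gamma_1|_\Delta=\gamma_2|_\Delta$ imply $\gamma_2\in A$. The measure denoted $\Omega_\Delta\,d\mu$ on $(X,\mathcal{B}_\Delta)$ is obtained via the evaluation map $\mathrm{ev}_\Delta(\gamma)=(\gamma(t_1),\ldots,\gamma(t_{n-1}))\in M^{n-1}$: the measure of $A\in\mathcal{B}_\Delta$ is $\int_{\mathrm{ev}_\Delta(A)}\Omega_\Delta(x_1,\ldots,x_{n-1})\,d\mu(x_1)\cdots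 d\mu(x_{n-1})$ (for $n=1$, $X$ has measure $\Omega(x,y)$). **Inverse system.** A morphism of measurable spaces is a measurable map. A morphism of complex measure spaces $(M_1,\mathcal{F}_1,\mu_1)\to(M_2,\mathcal{F}_2,\mu_2)$ is a measurable map $f$ with $f_*\mu_1=\mu_2$. For $\Delta_1\le\Delta_2$ (i.e. $\Delta_2$ refines $\Delta_1$) the transition map is the identity $(X,\mathcal{B}_{\Delta_2})\to(X,\mathcal{B}_{\Delta_1})$. *)

theory Defs
  imports "HOL-Analysis.Analysis"
begin

section \<open>Manifolds and Hermitian line bundles\<close>

text \<open>Hausdorffness and second countability are imposed through the type classes
  \<open>t2_space\<close> and \<open>second_countable_topology\<close> of the type of points.  The model space
  \<^const>\<open>Euclidean_space\<close> also covers dimension 0.\<close>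

definition locally_euclidean :: "'m::topological_space itself \<Rightarrow> bool" where
  "locally_euclidean _ \<longleftrightarrow>
     (\<exists>n. \<forall>p::'m. \<exists>U V. open U \<and> p \<in> U \<and> openin (Euclidean_space n) V \<and>
        subtopology euclidean U homeomorphic_space subtopology (Euclidean_space n) V)"

text \<open>A line bundle is given by its total space (the type \<open>'l\<close>), the projection, and
  operations that are only meaningful on vectors of a common fibre.\<close>

record ('m, 'l) line_bundle =
  bproj :: "'l \<Rightarrow> 'm"
  badd :: "'l \<Rightarrow> 'l \<Rightarrow> 'l"
  bscale :: "complex \<Rightarrow> 'l \<Rightarrow> 'l"
  bherm :: "'l \<Rightarrow> 'l \<Rightarrow> complex"

definition fibre :: "('m, 'l) line_bundle \<Rightarrow> 'm \<Rightarrow> 'l set" where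
  "fibre L x = {u. bproj L u = x}"

definition local_trivialization ::
  "('m::topological_space, 'l::topological_space) line_bundle \<Rightarrow> 'm set \<Rightarrow>
     ('l \<Rightarrow> 'm \<times> complex) \<Rightarrow> ('m \<times> complex \<Rightarrow> 'l) \<Rightarrow> bool" where
  "local_trivialization L U \<phi> \<psi> \<longleftrightarrow>
     open U \<and> homeomorphism (bproj L -` U) (U \<times> UNIV) \<phi> \<psi> \<and>
     (\<forall>u\<in>bproj L -` U. fst (\<phi> u) = bproj L u) \<and>
     (\<forall>x\<in>U. \<forall>u\<in>fibre L x. \<forall>v\<in>fibre L x. snd (\<phi> (badd L u v)) = snd (\<phi> u) + snd (\<phi> v)) \<and>
     (\<forall>x\<in>U. \<forall>c. \<forall>u\<in>fibre L x. snd (\<phi> (bscale L c u)) = c * snd (\<phi> u))"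

text \<open>The vector space axioms of the fibres are not listed separately: closure of the fibres
  under the operations together with the fibrewise bijections onto \<open>\<complex>\<close> that respect the
  operations make every fibre a one-dimensional complex vector space, with zero vector
  \<open>bscale L 0 u\<close>.  The metric is linear in the first and conjugate-linear in the second
  argument.\<close>

definition hermitian_line_bundle ::
  "('m::topological_space, 'l::topological_space) line_bundle \<Rightarrow> bool" where
  "hermitian_line_bundle L \<longleftrightarrow>
     (\<forall>x. \<forall>u\<in>fibre L x. \<forall>v\<in>fibre L x. badd L u v \<in> fibre L x) \<and>
     (\<forall>x. \<forall>c. \<forall>u\<in>fibre L x. bscale L c u \<in> fibre L x) \<and>
     (\<forall>x. \<exists>U \<phi> \<psi>. x \<in> U \<and> local_trivialization L U \<phi> \<psi>) \<and>
     (\<forall>x. \<forall>u\<in>fibre L x. \<forall>v\<in>fibre L x. \<forall>w\<in>fibre L x.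
        bherm L (badd L u v) w = bherm L u w + bherm L v w) \<and>
     (\<forall>x. \<forall>c. \<forall>u\<in>fibre L x. \<forall>v\<in>fibre L x. bherm L (bscale L c u) v = c * bherm L u v) \<and>
     (\<forall>x. \<forall>u\<in>fibre L x. \<forall>v\<in>fibre L x. bherm L v u = cnj (bherm L u v)) \<and>
     (\<forall>u. u \<noteq> bscale L 0 u \<longrightarrow> Re (bherm L u u) > 0) \<and>
     continuous_on {(u, v). bproj L u = bproj L v} (\<lambda>(u, v). bherm L u v)"


section \<open>Linear maps between fibres\<close>

text \<open>Maps between fibres are extensional, so that they are equal as soon as they agree on
  the fibre on which they are defined.\<close>

definition fibre_hom :: "('m, 'l) line_bundle \<Rightarrow> 'm \<Rightarrow> 'm \<Rightarrow> ('l \<Rightarrow> 'l) set" where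
  "fibre_hom L x y = {T \<in> fibre L x \<rightarrow>\<^sub>E fibre L y.
     (\<forall>u\<in>fibre L x. \<forall>v\<in>fibre L x. T (badd L u v) = badd L (T u) (T v)) \<and>
     (\<forall>c. \<forall>u\<in>fibre L x. T (bscale L c u) = bscale L c (T u))}"

text \<open>Composition from left to right: \<open>hom_mult L x S T\<close> is the product \<open>S T\<close> of \<open>S\<close>, starting
  at the fibre over \<open>x\<close>, and \<open>T\<close>, the maps acting on the right.\<close>

definition hom_mult :: "('m, 'l) line_bundle \<Rightarrow> 'm \<Rightarrow> ('l \<Rightarrow> 'l) \<Rightarrow> ('l \<Rightarrow> 'l) \<Rightarrow> ('l \<Rightarrow> 'l)" where
  "hom_mult L x S T = compose (fibre L x) T S"

definition hom_id :: "('m, 'l) line_bundle \<Rightarrow> 'm \<Rightarrow> 'l \<Rightarrow> 'l" where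
  "hom_id L x = restrict id (fibre L x)"

definition fibre_norm :: "('m, 'l) line_bundle \<Rightarrow> 'l \<Rightarrow> real" where
  "fibre_norm L u = sqrt (Re (bherm L u u))"

definition hom_norm :: "('m, 'l) line_bundle \<Rightarrow> 'm \<Rightarrow> ('l \<Rightarrow> 'l) \<Rightarrow> real" where
  "hom_norm L x T = (SUP u\<in>{u \<in> fibre L x. fibre_norm L u \<le> 1}. fibre_norm L (T u))"

definition is_hom_adjoint ::
  "('m, 'l) line_bundle \<Rightarrow> 'm \<Rightarrow> 'm \<Rightarrow> ('l \<Rightarrow> 'l) \<Rightarrow> ('l \<Rightarrow> 'l) \<Rightarrow> bool" where
  "is_hom_adjoint L x y S T \<longleftrightarrow>
     (\<forall>u\<in>fibre L x. \<forall>v\<in>fibre L y. bherm L (S u) v = bherm L u (T v))"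

text \<open>The integral over \<open>S\<close> of a function with values in the finite-dimensional vector space
  of linear maps from the fibre over \<open>x\<close> to the fibre over \<open>y\<close>, taken in the linear
  coordinates \<open>T \<mapsto> \<langle>T u, v\<rangle>\<close>.\<close>

definition has_hom_integral ::
  "('m, 'l) line_bundle \<Rightarrow> 'm \<Rightarrow> 'm \<Rightarrow> 'a measure \<Rightarrow> 'a set \<Rightarrow> ('a \<Rightarrow> 'l \<Rightarrow> 'l) \<Rightarrow> ('l \<Rightarrow> 'l) \<Rightarrow> bool"
where
  "has_hom_integral L x y N S F T \<longleftrightarrow>
     S \<in> sets N \<and> (\<forall>z\<in>S. F z \<in> fibre_hom L x y) \<and> T \<in> fibre_hom L x y \<and>
     (\<forall>u\<in>fibre L x. \<forall>v\<in>fibre L y.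
        has_bochner_integral N (\<lambda>z. indicator S z *\<^sub>R bherm L (F z u) v) (bherm L (T u) v))"

definition hom_integral ::
  "('m, 'l) line_bundle \<Rightarrow> 'm \<Rightarrow> 'm \<Rightarrow> 'a measure \<Rightarrow> 'a set \<Rightarrow> ('a \<Rightarrow> 'l \<Rightarrow> 'l) \<Rightarrow> 'l \<Rightarrow> 'l" where
  "hom_integral L x y N S F = (THE T. has_hom_integral L x y N S F T)"


section \<open>Propagators\<close>

text \<open>Continuity of a section of \<open>\<pi>\<^sub>0\<^sup>*L\<^sup>* \<otimes> \<pi>\<^sub>1\<^sup>*L\<close>, expressed in the bundle charts that pairs of
  local trivializations of \<open>L\<close> induce: there the section is the scalar function below.\<close>

definition continuous_hom_section ::
  "('m::topological_space, 'l::topological_space) line_bundle \<Rightarrow> ('m \<Rightarrow> 'm \<Rightarrow> 'l \<Rightarrow> 'l) \<Rightarrow> bool"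
where
  "continuous_hom_section L \<Omega> \<longleftrightarrow>
     (\<forall>x y. \<Omega> x y \<in> fibre_hom L x y) \<and>
     (\<forall>U \<phi> \<psi> U' \<phi>' \<psi>'. local_trivialization L U \<phi> \<psi> \<longrightarrow> local_trivialization L U' \<phi>' \<psi>' \<longrightarrow>
        continuous_on (U \<times> U') (\<lambda>(x, y). snd (\<phi>' (\<Omega> x y (\<psi> (x, 1))))))"

definition propagator ::
  "('m::topological_space, 'l::topological_space) line_bundle \<Rightarrow> 'm measure \<Rightarrow>
     ('m \<Rightarrow> 'm \<Rightarrow> 'l \<Rightarrow> 'l) \<Rightarrow> bool" where
  "propagator L \<mu> \<Omega> \<longleftrightarrow>
     continuous_hom_section L \<Omega> \<and>
     (\<forall>x. \<Omega> x x = hom_id L x) \<and>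
     (\<forall>x y. x \<noteq> y \<longrightarrow> hom_norm L x (\<Omega> x y) < 1) \<and>
     (\<forall>x y. is_hom_adjoint L x y (\<Omega> x y) (\<Omega> y x)) \<and>
     (\<forall>x y. has_hom_integral L x y \<mu> UNIV (\<lambda>z. hom_mult L x (\<Omega> x z) (\<Omega> z y)) (\<Omega> x y)) \<and>
     (SUP x. \<integral>\<^sup>+ y. ennreal (hom_norm L x (\<Omega> x y)) \<partial>\<mu>) < \<infinity>"


section \<open>Path space\<close>

definition path_space :: "'m::topological_space \<Rightarrow> 'm \<Rightarrow> (real \<Rightarrow> 'm) set" where
  "path_space x y =
     {\<gamma> \<in> extensional {0..1}. continuous_on {0..1} \<gamma> \<and> \<gamma> 0 = x \<and> \<gamma> 1 = y}"

definition compact_open :: "'m::topological_space \<Rightarrow> 'm \<Rightarrow> (real \<Rightarrow> 'm) topology" where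
  "compact_open x y = topology_generated_by
     {{\<gamma> \<in> path_space x y. \<gamma> ` K \<subseteq> U} | K U. K \<subseteq> {0..1} \<and> compact K \<and> open U}"

text \<open>Measurable spaces are rendered by \<open>measure\<close> with only \<^const>\<open>space\<close> and \<^const>\<open>sets\<close>
  being relevant.\<close>

definition path_borel :: "'m::topological_space \<Rightarrow> 'm \<Rightarrow> (real \<Rightarrow> 'm) measure" where
  "path_borel x y = sigma (path_space x y) {W. openin (compact_open x y) W}"

definition time_partitions :: "real set set" where
  "time_partitions = {D. finite D \<and> D \<subseteq> {0..1} \<and> 0 \<in> D \<and> 1 \<in> D}"

definition path_cyl_sets :: "'m::topological_space \<Rightarrow> 'm \<Rightarrow> real set \<Rightarrow> (real \<Rightarrow> 'm) set set" where
  "path_cyl_sets x y D = {A \<in> sets (path_borel x y).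
     \<forall>\<gamma>\<^sub>1\<in>path_space x y. \<forall>\<gamma>\<^sub>2\<in>path_space x y.
       \<gamma>\<^sub>1 \<in> A \<longrightarrow> restrict \<gamma>\<^sub>1 D = restrict \<gamma>\<^sub>2 D \<longrightarrow> \<gamma>\<^sub>2 \<in> A}"

definition path_cyl :: "'m::topological_space \<Rightarrow> 'm \<Rightarrow> real set \<Rightarrow> (real \<Rightarrow> 'm) measure" where
  "path_cyl x y D = sigma (path_space x y) (path_cyl_sets x y D)"

lemma topspace_compact_open: "topspace (compact_open x y) = path_space x y"
proof -
  have "path_space x y \<in> {{\<gamma> \<in> path_space x y. \<gamma> ` K \<subseteq> U} | K U. K \<subseteq> {0..1} \<and> compact K \<and> open U}"
    by (intro CollectI exI[of _ "{}"] exI[of _ UNIV]) auto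
  then show ?thesis
    unfolding compact_open_def topology_generated_by_topspace by (intro equalityI Sup_least Union_upper) auto
qed

lemma space_path_borel: "space (path_borel x y) = path_space x y"
  unfolding path_borel_def
  by (rule space_measure_of) (metis Pow_iff mem_Collect_eq openin_subset subsetI topspace_compact_open)

lemma sigma_algebra_path_cyl_sets: "sigma_algebra (path_space x y) (path_cyl_sets x y D)"
proof -
  have sub: "A \<subseteq> path_space x y" if "A \<in> path_cyl_sets x y D" for A
    using that sets.sets_into_space[of A "path_borel x y"]
    by (simp add: path_cyl_sets_def space_path_borel)
  show ?thesis
    unfolding sigma_algebra_iff2
  proof (intro conjI ballI allI impI)
    show "path_cyl_sets x y D \<subseteq> Pow (path_space x y)"
      using sub by blast
    show "{} \<in> path_cyl_sets x y D"
      by (simp add: path_cyl_sets_def)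
  next
    fix A assume A: "A \<in> path_cyl_sets x y D"
    have "path_space x y - A \<in> sets (path_borel x y)"
      using A sets.compl_sets[of A "path_borel x y"] by (simp add: path_cyl_sets_def space_path_borel)
    with A show "path_space x y - A \<in> path_cyl_sets x y D"
      by (simp add: path_cyl_sets_def) metis
  next
    fix A :: "nat \<Rightarrow> (real \<Rightarrow> 'a) set"
    assume "range A \<subseteq> path_cyl_sets x y D"
    then have A: "A i \<in> path_cyl_sets x y D" for i by blast
    have "(\<Union>i. A i) \<in> sets (path_borel x y)"
      using A by (intro sets.countable_UN) (auto simp: path_cyl_sets_def)
    moreover have "\<gamma>\<^sub>2 \<in> (\<Union>i. A i)"
      if "\<gamma>\<^sub>1 \<in> path_space x y" "\<gamma>\<^sub>2 \<in> path_space x y" "\<gamma>\<^sub>1 \<in> (\<Union>i. A i)"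
        "restrict \<gamma>\<^sub>1 D = restrict \<gamma>\<^sub>2 D" for \<gamma>\<^sub>1 \<gamma>\<^sub>2
    proof -
      from that(3) obtain i where "\<gamma>\<^sub>1 \<in> A i" by blast
      moreover have "\<forall>\<gamma>\<^sub>1\<in>path_space x y. \<forall>\<gamma>\<^sub>2\<in>path_space x y.
          \<gamma>\<^sub>1 \<in> A i \<longrightarrow> restrict \<gamma>\<^sub>1 D = restrict \<gamma>\<^sub>2 D \<longrightarrow> \<gamma>\<^sub>2 \<in> A i"
        using A[of i] unfolding path_cyl_sets_def mem_Collect_eq by (rule conjunct2)
      ultimately have "\<gamma>\<^sub>2 \<in> A i" using that(1,2,4) by metis
      then show ?thesis by (rule UN_I[OF UNIV_I])
    qed
    ultimately show "(\<Union>i. A i) \<in> path_cyl_sets x y D"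
      by (simp only: path_cyl_sets_def mem_Collect_eq) metis
  qed
qed

lemma space_path_cyl: "space (path_cyl x y D) = path_space x y"
  unfolding path_cyl_def
  by (rule space_measure_of)
    (rule sigma_algebra_path_cyl_sets[unfolded sigma_algebra_iff2, THEN conjunct1])

lemma sets_path_cyl: "sets (path_cyl x y D) = path_cyl_sets x y D"
  unfolding path_cyl_def by (rule sigma_algebra.sets_measure_of_eq[OF sigma_algebra_path_cyl_sets])


section \<open>The measures on path space\<close>

text \<open>For a partition \<open>D\<close>, given by \<open>0 = t\<^sub>0 < \<dots> < t\<^sub>n = 1\<close>, the number \<open>n\<close> is \<open>card D - 1\<close>, and
  \<open>M\<^sup>n\<^sup>-\<^sup>1\<close> is the product indexed by \<open>{1..<n}\<close>, a one-point space of mass 1 for \<open>n = 1\<close>.\<close>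

definition part_time :: "real set \<Rightarrow> nat \<Rightarrow> real" where
  "part_time D i = sorted_list_of_set D ! i"

definition inner_index :: "real set \<Rightarrow> nat set" where
  "inner_index D = {1..<card D - 1}"

definition part_product :: "'m measure \<Rightarrow> real set \<Rightarrow> (nat \<Rightarrow> 'm) measure" where
  "part_product \<mu> D = (\<Pi>\<^sub>M i\<in>inner_index D. \<mu>)"

definition part_eval :: "real set \<Rightarrow> (real \<Rightarrow> 'm) \<Rightarrow> nat \<Rightarrow> 'm" where
  "part_eval D \<gamma> = (\<lambda>i\<in>inner_index D. \<gamma> (part_time D i))"

text \<open>\<open>hom_chain L \<Omega> x [x\<^sub>1, \<dots>, x\<^sub>k] y\<close> is the product \<open>\<Omega>(x, x\<^sub>1) \<Omega>(x\<^sub>1, x\<^sub>2) \<dots> \<Omega>(x\<^sub>k, y)\<close>.\<close>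

fun hom_chain ::
  "('m, 'l) line_bundle \<Rightarrow> ('m \<Rightarrow> 'm \<Rightarrow> 'l \<Rightarrow> 'l) \<Rightarrow> 'm \<Rightarrow> 'm list \<Rightarrow> 'm \<Rightarrow> 'l \<Rightarrow> 'l" where
  "hom_chain L \<Omega> x [] y = \<Omega> x y"
| "hom_chain L \<Omega> x (z # zs) y = hom_mult L x (\<Omega> x z) (hom_chain L \<Omega> z zs y)"

definition part_amplitude ::
  "('m, 'l) line_bundle \<Rightarrow> ('m \<Rightarrow> 'm \<Rightarrow> 'l \<Rightarrow> 'l) \<Rightarrow> 'm \<Rightarrow> 'm \<Rightarrow> real set \<Rightarrow> (nat \<Rightarrow> 'm) \<Rightarrow> 'l \<Rightarrow> 'l"
where
  "part_amplitude L \<Omega> x y D \<xi> = hom_chain L \<Omega> x (map \<xi> [1..<card D - 1]) y"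

definition path_measure ::
  "('m, 'l) line_bundle \<Rightarrow> 'm measure \<Rightarrow> ('m \<Rightarrow> 'm \<Rightarrow> 'l \<Rightarrow> 'l) \<Rightarrow> 'm \<Rightarrow> 'm \<Rightarrow> real set \<Rightarrow>
     (real \<Rightarrow> 'm) set \<Rightarrow> 'l \<Rightarrow> 'l" where
  "path_measure L \<mu> \<Omega> x y D A =
     hom_integral L x y (part_product \<mu> D) (part_eval D ` A) (part_amplitude L \<Omega> x y D)"


section \<open>Complex and Hom-valued measures, inverse systems and limits\<close>

definition complex_measure :: "'a measure \<Rightarrow> ('a set \<Rightarrow> complex) \<Rightarrow> bool" where
  "complex_measure N m \<longleftrightarrow>
     m {} = 0 \<and>
     (\<forall>A::nat \<Rightarrow> 'a set. range A \<subseteq> sets N \<longrightarrow> disjoint_family A \<longrightarrow> (\<lambda>i. m (A i)) sums m (\<Union>i. A i))"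

text \<open>Since the space of linear maps between two fibres is finite-dimensional, countable
  additivity is convergence in the coordinates \<open>T \<mapsto> \<langle>T u, v\<rangle>\<close>.\<close>

definition hom_measure ::
  "('m, 'l) line_bundle \<Rightarrow> 'm \<Rightarrow> 'm \<Rightarrow> 'a measure \<Rightarrow> ('a set \<Rightarrow> 'l \<Rightarrow> 'l) \<Rightarrow> bool" where
  "hom_measure L x y N m \<longleftrightarrow>
     (\<forall>A\<in>sets N. m A \<in> fibre_hom L x y) \<and>
     (\<forall>u\<in>fibre L x. \<forall>v\<in>fibre L y. complex_measure N (\<lambda>A. bherm L (m A u) v))"

definition measure_morphism ::
  "'a measure \<Rightarrow> ('a set \<Rightarrow> 'c) \<Rightarrow> 'b measure \<Rightarrow> ('b set \<Rightarrow> 'c) \<Rightarrow> ('a \<Rightarrow> 'b) \<Rightarrow> bool" where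
  "measure_morphism N1 m1 N2 m2 f \<longleftrightarrow>
     f \<in> measurable N1 N2 \<and> (\<forall>A\<in>sets N2. m1 (f -` A \<inter> space N1) = m2 A)"

definition directed_index :: "'i set \<Rightarrow> ('i \<Rightarrow> 'i \<Rightarrow> bool) \<Rightarrow> bool" where
  "directed_index I le \<longleftrightarrow>
     I \<noteq> {} \<and> (\<forall>i\<in>I. le i i) \<and>
     (\<forall>i\<in>I. \<forall>j\<in>I. \<forall>k\<in>I. le i j \<longrightarrow> le j k \<longrightarrow> le i k) \<and>
     (\<forall>i\<in>I. \<forall>j\<in>I. \<exists>k\<in>I. le i k \<and> le j k)"

text \<open>The transition map \<open>f i j\<close>, for \<open>i \<le> j\<close>, goes from the \<open>j\<close>-th to the \<open>i\<close>-th space.\<close>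

definition hom_measure_inverse_system ::
  "('m, 'l) line_bundle \<Rightarrow> 'm \<Rightarrow> 'm \<Rightarrow> 'i set \<Rightarrow> ('i \<Rightarrow> 'i \<Rightarrow> bool) \<Rightarrow> ('i \<Rightarrow> 'a measure) \<Rightarrow>
     ('i \<Rightarrow> 'a set \<Rightarrow> 'l \<Rightarrow> 'l) \<Rightarrow> ('i \<Rightarrow> 'i \<Rightarrow> 'a \<Rightarrow> 'a) \<Rightarrow> bool" where
  "hom_measure_inverse_system L x y I le N m f \<longleftrightarrow>
     directed_index I le \<and>
     (\<forall>i\<in>I. hom_measure L x y (N i) (m i)) \<and>
     (\<forall>i\<in>I. \<forall>j\<in>I. le i j \<longrightarrow> measure_morphism (N j) (m j) (N i) (m i) (f i j)) \<and>
     (\<forall>i\<in>I. \<forall>z\<in>space (N i). f i i z = z) \<and>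
     (\<forall>i\<in>I. \<forall>j\<in>I. \<forall>k\<in>I. le i j \<longrightarrow> le j k \<longrightarrow> (\<forall>z\<in>space (N k). f i j (f j k z) = f i k z))"

definition measurable_cone ::
  "'i set \<Rightarrow> ('i \<Rightarrow> 'i \<Rightarrow> bool) \<Rightarrow> ('i \<Rightarrow> 'a measure) \<Rightarrow> ('i \<Rightarrow> 'i \<Rightarrow> 'a \<Rightarrow> 'a) \<Rightarrow>
     'z measure \<Rightarrow> ('i \<Rightarrow> 'z \<Rightarrow> 'a) \<Rightarrow> bool" where
  "measurable_cone I le N f Z g \<longleftrightarrow>
     (\<forall>i\<in>I. g i \<in> measurable Z (N i)) \<and>
     (\<forall>i\<in>I. \<forall>j\<in>I. le i j \<longrightarrow> (\<forall>z\<in>space Z. f i j (g j z) = g i z))"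

text \<open>The universal property of a limit in the category of measurable spaces.  The test
  spaces range over all measurable spaces carried by subsets of the type given by the
  first argument; a theorem in which that type is a type variable covers all of them.\<close>

definition is_measurable_limit ::
  "'z itself \<Rightarrow> 'i set \<Rightarrow> ('i \<Rightarrow> 'i \<Rightarrow> bool) \<Rightarrow> ('i \<Rightarrow> 'a measure) \<Rightarrow> ('i \<Rightarrow> 'i \<Rightarrow> 'a \<Rightarrow> 'a) \<Rightarrow>
     'b measure \<Rightarrow> ('i \<Rightarrow> 'b \<Rightarrow> 'a) \<Rightarrow> bool" where
  "is_measurable_limit _ I le N f P p \<longleftrightarrow>
     measurable_cone I le N f P p \<and>
     (\<forall>(Z::'z measure) g. measurable_cone I le N f Z g \<longrightarrow>
        (\<exists>!h. h \<in> measurable Z P \<inter> extensional (space Z) \<and>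
              (\<forall>i\<in>I. \<forall>z\<in>space Z. p i (h z) = g i z)))"

end

theory Submission
  imports Defs
begin

text \<open>Everything rests on a Borel measurable choice of a path between any two points of \<open>M\<close>: cover
  \<open>M\<close> by countably many charts with convex image, move inside the charts along straight segments
  to their centres and join the centres by fixed paths.  Gluing such paths yields a measurable
  section of every evaluation map, so the base of a cylinder set is the preimage of the set under
  this section and hence Borel, and bases behave well under refinement.

  A Borel unit section of the bundle turns the propagator into a scalar kernel \<open>w\<close> with
  \<open>|w(x,y)| = |\<Omega>(x,y)|\<close>.  As \<open>|w(x,\<cdot>)|\<close> is continuous with value 1 at \<open>x\<close>, condition (5) makes \<open>\<mu>\<close>
  locally finite, hence \<open>\<sigma>\<close>-finite.  So Fubini applies: (5) and \<open>|w| \<le> 1\<close> make the product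
  of kernels integrable, and the semigroup property (4) gives consistency under insertion of
  one time at a time.

  For the limit, the Borel \<open>\<sigma>\<close>-algebra of the compact-open topology is generated by
  the evaluations, each of which is measurable for a finite partition.\<close>

text \<open>The measure of a cylinder set \<open>A\<close> is an integral over the image of
  \<open>A\<close> under \<open>part_eval D\<close>, and the image of a Borel set need not be Borel
  in general; this is the obstacle that the section removes. The section also shows that every tuple
  of intermediate points lies on some path. This surjectivity makes the base of \<open>A\<close> at
  a finer partition the full preimage of the base at the coarser one, so that Fubini can integrate
  the new variable over all of \<open>M\<close>. In general, neither paths between two points nor
  unit vectors in the fibres can be chosen continuously over all of \<open>M\<close>. Both are
  therefore chosen on the pieces of a countable Borel partition. The statement numbers the
  coordinates by rank, and ranks shift when a time is inserted. The proof indexes the products by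
  the interior times \<open>D - {0, 1}\<close> themselves and returns to ranks only in
  \<open>part_eval_image_integral\<close>. For the limit, a compact-open condition constrains a path
  at uncountably many times; second countability and regularity of \<open>M\<close> reduce it to
  countably many evaluations.\<close>

section \<open>Measurable selection of paths on a manifold\<close>

text \<open>A box in the model coordinates is convex, so straight segments between its points stay
  inside and can be carried back by the inverse chart \<open>g\<close>. Joint continuity in both
  endpoints and the time is what the measurable selection later relies on.\<close>

lemma contractible_chart:
  fixes p :: "'m::topological_space"
  assumes "locally_euclidean TYPE('m)"
  obtains W and c :: "'m \<Rightarrow> 'm \<Rightarrow> real \<Rightarrow> 'm"
  where "open W" "p \<in> W" "continuous_on (W \<times> W \<times> {0..1}) (\<lambda>(a, b, t). c a b t)"
    "\<And>a b. a \<in> W \<Longrightarrow> b \<in> W \<Longrightarrow> c a b 0 = a" "\<And>a b. a \<in> W \<Longrightarrow> b \<in> W \<Longrightarrow> c a b 1 = b"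
proof -
  obtain n U V where U: "open U" "p \<in> U" and V: "openin (Euclidean_space n) V"
    and hom: "subtopology euclidean U homeomorphic_space subtopology (Euclidean_space n) V"
    using assms unfolding locally_euclidean_def by meson
  \<comment> \<open>The model space consists of the real sequences vanishing from index
    \<open>n\<close> on. A segment stays in \<open>E\<close> by linearity and in the ambient open
    set \<open>T\<close> by convexity of a box; together this gives \<open>V\<close>.\<close>
  define E where "E = {x::nat \<Rightarrow> real. \<forall>i\<ge>n. x i = 0}"
  have Eeq: "Euclidean_space n = top_of_set E"
    by (simp add: Euclidean_space_def E_def euclidean_product_topology)
  obtain T where T: "open T" "V = E \<inter> T"
    using V unfolding Eeq openin_open by auto
  have sub: "subtopology (Euclidean_space n) V = top_of_set V"
    by (simp add: Eeq subtopology_subtopology T Int_absorb1)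
  obtain f g where fg: "homeomorphic_maps (top_of_set U) (top_of_set V) f g"
    using hom unfolding sub homeomorphic_space_def by blast
  then have f: "continuous_on U f" "f ` U \<subseteq> V" and g: "continuous_on V g"
    and gf: "\<And>a. a \<in> U \<Longrightarrow> g (f a) = a"
    unfolding homeomorphic_maps_def by (auto simp: continuous_map_subtopology_eu image_subset_iff_funcset Pi_iff)
  have "f p \<in> T" using f(2) U(2) T(2) by auto
  with T(1) have "\<exists>X. f p \<in> (\<Pi>\<^sub>E i\<in>UNIV. X i) \<and> (\<forall>i. open (X i)) \<and> finite {i. X i \<noteq> UNIV} \<and> (\<Pi>\<^sub>E i\<in>UNIV. X i) \<subseteq> T"
    using product_topology_open_contains_basis[of "\<lambda>_. euclidean" UNIV T "f p"]
    unfolding open_fun_def by simp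
  then obtain X where X: "\<And>i. f p i \<in> X i" "\<And>i. open (X i)" "finite {i. X i \<noteq> UNIV}" "(\<Pi>\<^sub>E i\<in>UNIV. X i) \<subseteq> T"
    by (auto simp: PiE_iff)
  have "\<exists>e>0. ball (f p i) e \<subseteq> X i" for i
    using X(1,2) open_contains_ball by blast
  then obtain e where e: "\<And>i. e i > 0" "\<And>i. ball (f p i) (e i) \<subseteq> X i" by metis
  \<comment> \<open>A basic open set of the product need not have convex factors. The constrained
    factors are shrunk to balls; the free ones stay \<open>UNIV\<close>, so that only finitely many
    coordinates are constrained and the box remains open.\<close>
  define B where "B i = (if X i = UNIV then UNIV else ball (f p i) (e i))" for i
  have B: "open (B i)" "convex (B i)" "f p i \<in> B i" "B i \<subseteq> X i" for i
    using e[of i] by (auto simp: B_def)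
  have "finite {i. B i \<noteq> UNIV}"
    by (rule finite_subset[OF _ X(3)]) (auto simp: B_def)
  then have Bo: "open (Pi\<^sub>E UNIV B)" by (intro open_PiE B)
  have BT: "Pi\<^sub>E UNIV B \<subseteq> T" using X(4) B(4) by (fastforce simp: PiE_iff)
  define W where "W = U \<inter> f -` Pi\<^sub>E UNIV B"
  define s where "s = (\<lambda>(a, b, t) i. (1 - t) * f a i + t * f b i)"
  define c where "c a b t = g (s (a, b, t))" for a b t
  have WU: "W \<subseteq> U" by (auto simp: W_def)
  show thesis
  proof
    show "open W" unfolding W_def using continuous_open_preimage[OF f(1) U(1) Bo] .
    show "p \<in> W" using U B by (auto simp: W_def)
    have fW: "continuous_on W f" using f(1) WU continuous_on_subset by blast
    have co: "continuous_on (W \<times> W \<times> {0..1}) s"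
    proof (rule continuous_on_coordinatewise_then_product)
      fix i
      have ci: "continuous_on W (\<lambda>a. f a i)"
        using fW by (rule continuous_on_product_then_coordinatewise)
      have "continuous_on (W \<times> W \<times> {0..1::real}) (\<lambda>x. f (fst x) i)"
        "continuous_on (W \<times> W \<times> {0..1::real}) (\<lambda>x. f (fst (snd x)) i)"
        by (rule continuous_on_compose2[OF ci]; auto intro!: continuous_intros)+
      then show "continuous_on (W \<times> W \<times> {0..1}) (\<lambda>x. s x i)"
        unfolding s_def case_prod_beta by (intro continuous_intros) auto
    qed
    have im: "s ` (W \<times> W \<times> {0..1}) \<subseteq> V"
    proof clarify
      fix a b :: 'm and t :: real assume ab: "a \<in> W" "b \<in> W" and t: "t \<in> {0..1}"
      have "f a \<in> E" "f b \<in> E" using ab f(2) T(2) WU by auto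
      then have "s (a, b, t) \<in> E" by (simp add: E_def s_def)
      moreover have "s (a, b, t) i \<in> B i" for i
        using convexD[OF B(2)[of i], of "f a i" "f b i" "1 - t" t] ab t
        by (auto simp: s_def W_def PiE_iff)
      then have "s (a, b, t) \<in> T" using BT by (auto simp: PiE_iff)
      ultimately show "s (a, b, t) \<in> V" using T(2) by simp
    qed
    show "continuous_on (W \<times> W \<times> {0..1}) (\<lambda>(a, b, t). c a b t)"
      using continuous_on_compose2[OF g co im] by (simp add: c_def case_prod_beta)
    show "c a b 0 = a" if "a \<in> W" "b \<in> W" for a b
      using that WU by (auto simp: c_def s_def gf)
    show "c a b 1 = b" if "a \<in> W" "b \<in> W" for a b
      using that WU by (auto simp: c_def s_def gf)
  qed
qed

text \<open>Charts transport local compactness from open subsets of Euclidean space, and locally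
  compact Hausdorff spaces are regular. Regularity is used to fit closures of basic sets inside a
  given open set.\<close>

lemma locally_euclidean_imp_regular:
  assumes "locally_euclidean TYPE('m::t2_space)"
  shows "regular_space (euclidean :: 'm topology)"
proof (rule locally_compact_Hausdorff_imp_regular_space)
  show "Hausdorff_space (euclidean :: 'm topology)"
    unfolding Hausdorff_space_def disjnt_def using hausdorff by auto
  show "locally_compact_space (euclidean :: 'm topology)"
    unfolding locally_compact_space_def
  proof
    fix p :: 'm
    obtain n U V where U: "open U" "p \<in> U" and V: "openin (Euclidean_space n) V"
      and hom: "subtopology euclidean U homeomorphic_space subtopology (Euclidean_space n) V"
      using assms unfolding locally_euclidean_def by meson
    have "locally_compact_space (subtopology (Euclidean_space n) V)"
      by (intro locally_compact_space_open_subset locally_compact_Euclidean_space V disjI1 Hausdorff_Euclidean_space)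
    then have "locally_compact_space (top_of_set U)"
      using homeomorphic_locally_compact_space[OF hom] by simp
    then obtain A K where A: "openin (top_of_set U) A" "compactin (top_of_set U) K" "p \<in> A" "A \<subseteq> K"
      unfolding locally_compact_space_def using U by force
    then have "open A" using U openin_open_trans by blast
    with A show "\<exists>A K. openin euclidean A \<and> compactin euclidean K \<and> p \<in> A \<and> A \<subseteq> K"
      by (auto simp: compactin_subtopology)
  qed
qed

text \<open>Path components are open because each point is joined to all of a chart neighbourhood;
  connectedness then leaves a single component.\<close>

lemma locally_euclidean_paths:
  fixes p q :: "'m::topological_space"
  assumes "locally_euclidean TYPE('m)" "connected (UNIV :: 'm set)"
  obtains g where "path g" "pathstart g = p" "pathfinish g = q"
proof -
  have "path_component (UNIV :: 'm set) p q"
  proof (rule connected_equivalence_relation[OF assms(2)])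
    fix a :: 'm
    obtain W and c :: "'m \<Rightarrow> 'm \<Rightarrow> real \<Rightarrow> 'm" where W: "open W" "a \<in> W" and c: "continuous_on (W \<times> W \<times> {0..1}) (\<lambda>(a, b, t). c a b t)"
      "\<And>a b. a \<in> W \<Longrightarrow> b \<in> W \<Longrightarrow> c a b 0 = a" "\<And>a b. a \<in> W \<Longrightarrow> b \<in> W \<Longrightarrow> c a b 1 = b"
      by (rule contractible_chart[OF assms(1), of a]) blast
    have "path_component UNIV a b" if "b \<in> W" for b
    proof -
      have "continuous_on {0..1} (\<lambda>t. case (a, b, t) of (a, b, t) \<Rightarrow> c a b t)"
        by (rule continuous_on_compose2[OF c(1)]) (use W that in \<open>auto intro!: continuous_intros\<close>)
      then show ?thesis
        unfolding path_component_def path_def pathstart_def pathfinish_def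
        by (intro exI[of _ "c a b"]) (use c W that in auto)
    qed
    then show "\<exists>T. openin (top_of_set UNIV) T \<and> a \<in> T \<and> (\<forall>b\<in>T. path_component UNIV a b)"
      using W by auto
  qed (auto intro: path_component_sym path_component_trans)
  then show ?thesis
    using that by (auto simp: path_component_def)
qed

text \<open>Lindelof's theorem as a sequence. It is applied to chart domains, to trivializing sets
  and to open sets of finite measure.\<close>

lemma countable_open_cover:
  fixes P :: "'a::second_countable_topology set \<Rightarrow> bool"
  assumes "\<And>p. \<exists>U. open U \<and> p \<in> U \<and> P U"
  obtains U :: "nat \<Rightarrow> 'a set" where "\<And>n. open (U n)" "\<And>n. P (U n)" "(\<Union>n. U n) = UNIV"
proof -
  define \<F> where "\<F> = {U. open U \<and> P U}"
  obtain \<F>' where F: "\<F>' \<subseteq> \<F>" "countable \<F>'" "\<Union>\<F>' = \<Union>\<F>"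
    by (rule Lindelof[of \<F>]) (auto simp: \<F>_def)
  have "\<Union>\<F> = UNIV" using assms by (auto simp: \<F>_def)
  with F have UN: "\<Union>\<F>' = UNIV" by simp
  then have ne: "\<F>' \<noteq> {}" by auto
  have r: "range (from_nat_into \<F>') = \<F>'" using F(2) ne by (rule range_from_nat_into[rotated])
  show thesis
  proof (rule that[of "from_nat_into \<F>'"])
    show "open (from_nat_into \<F>' n)" "P (from_nat_into \<F>' n)" for n
      using from_nat_into[OF ne, of n] F(1) by (auto simp: \<F>_def)
    show "(\<Union>n. from_nat_into \<F>' n) = UNIV" using UN r by simp
  qed
qed

text \<open>The level sets of this function form a countable Borel partition subordinate to the
  cover, so a choice made once for each \<open>n\<close> becomes a Borel choice at every
  point.\<close>

definition cover_index :: "(nat \<Rightarrow> 'a set) \<Rightarrow> 'a \<Rightarrow> nat" where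
  "cover_index U a = (LEAST n. a \<in> U n)"

lemma cover_index: "(\<Union>n. U n) = UNIV \<Longrightarrow> a \<in> U (cover_index U a)"
  unfolding cover_index_def by (rule LeastI_ex) auto

lemma borel_cover_index_fibre:
  fixes U :: "nat \<Rightarrow> 'a::topological_space set"
  assumes "\<And>n. open (U n)" "(\<Union>n. U n) = UNIV"
  shows "{a. cover_index U a = n} \<in> sets borel"
proof -
  have *: "cover_index U a = n \<longleftrightarrow> a \<in> U n \<and> (\<forall>m<n. a \<notin> U m)" for a
    using cover_index[OF assms(2), of a] unfolding cover_index_def
    by (metis LeastI_ex Least_le linorder_not_le nle_le not_less_Least)
  have "{a. cover_index U a = n} = U n - (\<Union>m<n. U m)" by (auto simp: *)
  then show ?thesis using assms(1) by auto
qed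

text \<open>Different pieces use different charts, so continuity can be expected only on products of
  two level sets. These are countably many Borel rectangles, second countability identifying the
  Borel sets of the square with the product \<open>\<sigma>\<close>-algebra.\<close>

lemma borel_measurable_if_continuous_on_cover:
  fixes f :: "'a::second_countable_topology \<times> 'a \<Rightarrow> 'b::topological_space"
  assumes U: "\<And>n. open (U n)" "(\<Union>n. U n) = UNIV"
    and f: "\<And>i j. continuous_on ({a. cover_index U a = i} \<times> {b. cover_index U b = j}) f"
  shows "f \<in> borel_measurable borel"
proof (rule measurable_piecewise_restrict)
  let ?A = "\<lambda>i. {a. cover_index U a = i}"
  let ?C = "(\<lambda>(i, j). ?A i \<times> ?A j) ` UNIV"
  show "countable ?C" by auto
  show "space borel \<subseteq> \<Union>?C" by auto
  fix S assume "S \<in> ?C"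
  then obtain i j where S: "S = ?A i \<times> ?A j" by auto
  have "?A i \<times> ?A j \<in> sets (borel \<Otimes>\<^sub>M borel)"
    by (intro pair_measureI borel_cover_index_fibre U)
  then show "S \<inter> space borel \<in> sets borel" by (simp add: S borel_prod[symmetric])
  show "f \<in> borel_measurable (restrict_space borel S)"
    unfolding S by (rule borel_measurable_continuous_on_restrict[OF f])
qed

text \<open>For fixed \<open>t\<close> the position of \<open>t\<close> among the breakpoints
  decides which of the three pieces is evaluated. On a product of level sets the charts and the
  joining path are fixed, so that piece is continuous in the endpoints.\<close>

lemma borel_path_selection:
  assumes "locally_euclidean TYPE('m::second_countable_topology)" "connected (UNIV :: 'm::second_countable_topology set)"
  obtains \<sigma> :: "'m::second_countable_topology \<Rightarrow> 'm \<Rightarrow> real \<Rightarrow> 'm"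
  where "\<And>a b. continuous_on {0..1} (\<sigma> a b)" "\<And>a b. \<sigma> a b 0 = a" "\<And>a b. \<sigma> a b 1 = b"
    "\<And>t. t \<in> {0..1} \<Longrightarrow> (\<lambda>(a, b). \<sigma> a b t) \<in> borel_measurable borel"
proof -
  define P where "P W \<longleftrightarrow> (\<exists>p c. p \<in> W \<and> continuous_on (W \<times> W \<times> {0..1}) (\<lambda>(a, b, t). c a b t) \<and>
    (\<forall>a\<in>W. \<forall>b\<in>W. c a b (0::real) = a \<and> c a b 1 = b))" for W :: "'m set"
  have "\<exists>U. open U \<and> p \<in> U \<and> P U" for p
  proof -
    obtain W and c :: "'m \<Rightarrow> 'm \<Rightarrow> real \<Rightarrow> 'm" where W: "open W" "p \<in> W"
      and c: "continuous_on (W \<times> W \<times> {0..1}) (\<lambda>(a, b, t). c a b t)"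
      and c01: "\<And>a b. a \<in> W \<Longrightarrow> b \<in> W \<Longrightarrow> c a b 0 = a" "\<And>a b. a \<in> W \<Longrightarrow> b \<in> W \<Longrightarrow> c a b 1 = b"
      by (rule contractible_chart[OF assms(1), of p]) blast
    have "P W" unfolding P_def using W(2) c c01 by (intro exI[of _ p] exI[of _ c]) simp
    then show ?thesis using W by (intro exI[of _ W]) simp
  qed
  from countable_open_cover[of P, OF this] obtain U
    where U: "\<And>n::nat. open (U n)" "\<And>n. P (U n)" "(\<Union>n. U n) = UNIV" by blast
  from U(2)[unfolded P_def] obtain p c where p: "\<And>n. p n \<in> U n"
    and c: "\<And>n. continuous_on (U n \<times> U n \<times> {0..1}) (\<lambda>(a, b, t). c n a b t)"
    and c01: "\<And>n a b. a \<in> U n \<Longrightarrow> b \<in> U n \<Longrightarrow> c n a b (0::real) = a"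
      "\<And>n a b. a \<in> U n \<Longrightarrow> b \<in> U n \<Longrightarrow> c n a b 1 = b" by metis
  have "\<exists>g. path g \<and> pathstart g = p i \<and> pathfinish g = p j" for i j
    using locally_euclidean_paths[OF assms, of "p i" "p j"] by metis
  then obtain g where g: "\<And>i j. path (g i j)" "\<And>i j. pathstart (g i j) = p i"
      "\<And>i j. pathfinish (g i j) = p j" by metis
  define i where "i = cover_index U"
  have iU: "a \<in> U (i a)" for a unfolding i_def by (rule cover_index[OF U(3)])
  have cpath: "path (c n a b)" "pathstart (c n a b) = a" "pathfinish (c n a b) = b"
    if "a \<in> U n" "b \<in> U n" for n a b
  proof -
    have "continuous_on {0..1} (\<lambda>t. case (a, b, t) of (a, b, t) \<Rightarrow> c n a b t)"
      by (rule continuous_on_compose2[OF c]) (use that in \<open>auto intro!: continuous_intros\<close>)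
    then show "path (c n a b)" "pathstart (c n a b) = a" "pathfinish (c n a b) = b"
      using c01 that by (auto simp: path_def pathstart_def pathfinish_def)
  qed
  define \<sigma> where "\<sigma> a b = c (i a) a (p (i a)) +++ (g (i a) (i b) +++ c (i b) (p (i b)) b)" for a b
  have \<sigma>: "path (\<sigma> a b)" "pathstart (\<sigma> a b) = a" "pathfinish (\<sigma> a b) = b" for a b
    by (auto simp: \<sigma>_def g cpath iU p)
  show thesis
  proof (rule that[of \<sigma>])
    show "continuous_on {0..1} (\<sigma> a b)" "\<sigma> a b 0 = a" "\<sigma> a b 1 = b" for a b
      using \<sigma>[of a b] by (auto simp: path_def pathstart_def pathfinish_def)
    fix t :: real assume t: "t \<in> {0..1}"
    show "(\<lambda>(a, b). \<sigma> a b t) \<in> borel_measurable borel"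
    proof (rule borel_measurable_if_continuous_on_cover[OF U(1,3)])
      fix m n
      let ?S = "{a. cover_index U a = m} \<times> {b. cover_index U b = n}"
      have S: "i (fst z) = m" "i (snd z) = n" "fst z \<in> U m" "snd z \<in> U n" if "z \<in> ?S" for z
        using that iU[of "fst z"] iU[of "snd z"] by (auto simp: i_def)
      have c1: "continuous_on ?S (\<lambda>z. c m (fst z) (p m) s)" if "s \<in> {0..1}" for s
      proof -
        have "continuous_on ?S (\<lambda>z. case (fst z, p m, s) of (a, b, t) \<Rightarrow> c m a b t)"
          by (rule continuous_on_compose2[OF c[of m]]) (use S p that in \<open>auto intro!: continuous_intros\<close>)
        then show ?thesis by simp
      qed
      have c2: "continuous_on ?S (\<lambda>z. c n (p n) (snd z) s)" if "s \<in> {0..1}" for s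
      proof -
        have "continuous_on ?S (\<lambda>z. case (p n, snd z, s) of (a, b, t) \<Rightarrow> c n a b t)"
          by (rule continuous_on_compose2[OF c[of n]]) (use S p that in \<open>auto intro!: continuous_intros\<close>)
        then show ?thesis by simp
      qed
      \<comment> \<open>The join is nested to the right, so its breakpoints are 1/2 and 3/4; the
        second appears as \<open>2 * t - 1 = 1/2\<close> in the parameter of the inner join.\<close>
      consider "t \<le> 1/2" | "t > 1/2" "2 * t - 1 \<le> 1/2" | "t > 1/2" "2 * t - 1 > 1/2" by linarith
      then have "continuous_on ?S (\<lambda>z. \<sigma> (fst z) (snd z) t)"
      proof cases
        case 1
        then have "\<sigma> (fst z) (snd z) t = c m (fst z) (p m) (2 * t)" if "z \<in> ?S" for z
          using S[OF that] by (simp add: \<sigma>_def joinpaths_def)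
        then show ?thesis using c1[of "2 * t"] t 1 by (simp cong: continuous_on_cong_simp)
      next
        case 2
        then have "\<sigma> (fst z) (snd z) t = g m n (2 * (2 * t - 1))" if "z \<in> ?S" for z
          using S[OF that] by (simp add: \<sigma>_def joinpaths_def)
        then show ?thesis by (simp cong: continuous_on_cong_simp)
      next
        case 3
        then have "\<sigma> (fst z) (snd z) t = c n (p n) (snd z) (2 * (2 * t - 1) - 1)" if "z \<in> ?S" for z
          using S[OF that] by (simp add: \<sigma>_def joinpaths_def)
        then show ?thesis using c2[of "2 * (2 * t - 1) - 1"] t 3 by (simp cong: continuous_on_cong_simp)
      qed
      then show "continuous_on ?S (\<lambda>(a, b). \<sigma> a b t)" by (simp add: case_prod_beta)
    qed
  qed
qed

section \<open>The Borel sets of the path space\<close>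

lemma open_in_path_borel:
  "openin (compact_open x y) S \<Longrightarrow> S \<in> sets (path_borel x y)"
proof -
  have "{W. openin (compact_open x y) W} \<subseteq> Pow (path_space x y)"
    using openin_subset[of "compact_open x y"] by (auto simp: topspace_compact_open)
  then show "openin (compact_open x y) S \<Longrightarrow> S \<in> sets (path_borel x y)"
    by (auto simp: path_borel_def sets_measure_of)
qed

lemma measurable_path_eval:
  assumes "t \<in> {0..1}"
  shows "(\<lambda>\<gamma>. \<gamma> t) \<in> borel_measurable (path_borel x y)"
proof (rule borel_measurableI)
  fix U :: "'a set" assume "open U"
  then have "openin (compact_open x y) {\<gamma> \<in> path_space x y. \<gamma> ` {t} \<subseteq> U}"
    unfolding compact_open_def using assms
    by (intro topology_generated_by_Basis CollectI exI[of _ "{t}"] exI[of _ U]) simp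
  moreover have "(\<lambda>\<gamma>. \<gamma> t) -` U \<inter> space (path_borel x y) = {\<gamma> \<in> path_space x y. \<gamma> ` {t} \<subseteq> U}"
    by (auto simp: space_path_borel)
  ultimately show "(\<lambda>\<gamma>. \<gamma> t) -` U \<inter> space (path_borel x y) \<in> sets (path_borel x y)"
    by (simp add: open_in_path_borel)
qed

text \<open>A countable replacement for the defining subbasis of the compact-open topology when
  \<open>\<B>\<close> is countable. The interval is cut with \<open>{0..1}\<close> because a time at
  an end of the unit interval needs rational bounds on both sides.\<close>

definition rational_subbasis :: "'m::topological_space set set \<Rightarrow> 'm \<Rightarrow> 'm \<Rightarrow> (real \<Rightarrow> 'm) set set" where
  "rational_subbasis \<B> x y =
     (\<lambda>(p, q, B). {\<gamma> \<in> path_space x y. \<gamma> ` ({p..q} \<inter> {0..1}) \<subseteq> B}) ` (\<rat> \<times> \<rat> \<times> \<B>)"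

lemma countable_rational_subbasis: "countable \<B> \<Longrightarrow> countable (rational_subbasis \<B> x y)"
  unfolding rational_subbasis_def by (intro countable_image countable_SIGMA countable_rat)

text \<open>By continuity each time in \<open>K\<close> lies inside a rational interval that
  \<open>\<gamma>\<close> maps into a basic set contained in \<open>U\<close>; compactness of
  \<open>K\<close> keeps finitely many of these intervals.\<close>

lemma rational_subbasis_refines:
  fixes \<gamma> :: "real \<Rightarrow> 'm::topological_space"
  assumes \<B>: "topological_basis \<B>" and \<gamma>: "\<gamma> \<in> path_space x y"
    and K: "compact K" "K \<subseteq> {0..1}" and U: "open U" "\<gamma> ` K \<subseteq> U"
  shows "\<exists>F. finite F \<and> F \<subseteq> rational_subbasis \<B> x y \<and> \<gamma> \<in> \<Inter>F \<and>
    path_space x y \<inter> \<Inter>F \<subseteq> {\<gamma> \<in> path_space x y. \<gamma> ` K \<subseteq> U}"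
proof -
  have cont: "continuous_on {0..1} \<gamma>" using \<gamma> by (simp add: path_space_def)
  have "\<exists>V C. open V \<and> t \<in> V \<and> C \<in> rational_subbasis \<B> x y \<and> \<gamma> \<in> C \<and> (\<forall>\<gamma>'\<in>C. \<gamma>' ` (V \<inter> {0..1}) \<subseteq> U)"
    if t: "t \<in> K" for t
  proof -
    obtain B where B: "B \<in> \<B>" "\<gamma> t \<in> B" "B \<subseteq> U"
      using topological_basisE[OF \<B> U(1), of "\<gamma> t"] U(2) t by blast
    obtain A where A: "open A" "A \<inter> {0..1} = \<gamma> -` B \<inter> {0..1}"
      using cont topological_basis_open[OF \<B> B(1)] unfolding continuous_on_open_invariant by blast
    have "t \<in> A" using A(2) B(2) K(2) t by auto
    then obtain e where e: "e > 0" "ball t e \<subseteq> A" using A(1) open_contains_ball by blast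
    obtain p where p: "p \<in> \<rat>" "t - e < p" "p < t" using Rats_dense_in_real[of "t - e" t] e by auto
    obtain q where q: "q \<in> \<rat>" "t < q" "q < t + e" using Rats_dense_in_real[of t "t + e"] e by auto
    have "{p..q} \<subseteq> ball t e"
    proof
      fix s assume "s \<in> {p..q}"
      then show "s \<in> ball t e" using p q by (simp add: dist_real_def abs_less_iff)
    qed
    then have sub: "\<gamma> ` ({p..q} \<inter> {0..1}) \<subseteq> B" using A(2) e(2) by blast
    let ?C = "{\<gamma> \<in> path_space x y. \<gamma> ` ({p..q} \<inter> {0..1}) \<subseteq> B}"
    show ?thesis
    proof (intro exI conjI ballI)
      show "?C \<in> rational_subbasis \<B> x y"
        unfolding rational_subbasis_def by (rule image_eqI[of _ _ "(p, q, B)"]) (use p q B in auto)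
      show "\<gamma> \<in> ?C" using \<gamma> sub by simp
      \<comment> \<open>The open interval serves in the cover of \<open>K\<close>, the closed one in
        the subbasic condition.\<close>
      show "open {p<..<q}" "t \<in> {p<..<q}" using p q by auto
      fix \<gamma>' assume "\<gamma>' \<in> ?C"
      then have "\<gamma>' ` ({p..q} \<inter> {0..1}) \<subseteq> B" by simp
      moreover have "{p<..<q} \<inter> {0..1} \<subseteq> {p..q} \<inter> {0..1}" by auto
      ultimately show "\<gamma>' ` ({p<..<q} \<inter> {0..1}) \<subseteq> U" using B(3) by blast
    qed
  qed
  then obtain V C where H: "\<And>t. t \<in> K \<Longrightarrow> open (V t)" "\<And>t. t \<in> K \<Longrightarrow> t \<in> V t"
      "\<And>t. t \<in> K \<Longrightarrow> C t \<in> rational_subbasis \<B> x y" "\<And>t. t \<in> K \<Longrightarrow> \<gamma> \<in> C t"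
      "\<And>t \<gamma>'. t \<in> K \<Longrightarrow> \<gamma>' \<in> C t \<Longrightarrow> \<gamma>' ` (V t \<inter> {0..1}) \<subseteq> U" by metis
  have "K \<subseteq> (\<Union>t\<in>K. V t)" using H(2) by blast
  with K(1) H(1) obtain T where T: "T \<subseteq> K" "finite T" "K \<subseteq> (\<Union>t\<in>T. V t)"
    by (rule compactE_image)
  show ?thesis
  proof (intro exI[of _ "C ` T"] conjI subsetI)
    fix \<gamma>' assume *: "\<gamma>' \<in> path_space x y \<inter> \<Inter>(C ` T)"
    have "\<gamma>' s \<in> U" if s: "s \<in> K" for s
    proof -
      obtain t where t: "t \<in> T" "s \<in> V t" using T(3) s by blast
      then have "\<gamma>' ` (V t \<inter> {0..1}) \<subseteq> U" using * T(1) by (intro H(5)) auto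
      then show ?thesis using t s K(2) by blast
    qed
    then show "\<gamma>' \<in> {\<gamma> \<in> path_space x y. \<gamma> ` K \<subseteq> U}" using * by auto
  next
    fix S assume "S \<in> C ` T"
    then show "S \<in> rational_subbasis \<B> x y" using H(3) T(1) by blast
  next
    show "\<gamma> \<in> \<Inter>(C ` T)" using H(4) T(1) by blast
  qed (use T(2) in simp)
qed

text \<open>There are only countably many finite \<open>F\<close> when \<open>\<B>\<close> is
  countable, so every open set of paths is a countable union of finite intersections. The factor
  \<open>path_space x y\<close> is there for \<open>F = {}\<close>, whose intersection is
  \<open>UNIV\<close>; this happens for \<open>K = {}\<close>.\<close>

lemma compact_open_rational_subbasis:
  assumes \<B>: "topological_basis \<B>" and S: "openin (compact_open x y) S" and \<gamma>: "\<gamma> \<in> S"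
  shows "\<exists>F. finite F \<and> F \<subseteq> rational_subbasis \<B> x y \<and> \<gamma> \<in> \<Inter>F \<and> path_space x y \<inter> \<Inter>F \<subseteq> S"
  using openin_topology_generated_by[OF S[unfolded compact_open_def]] \<gamma>
proof (induction arbitrary: \<gamma> rule: generate_topology_on.induct)
  case Empty
  then show ?case by simp
next
  case (Int a b)
  from Int.prems have "\<gamma> \<in> a" "\<gamma> \<in> b" by auto
  from Int.IH(1)[OF this(1)] obtain F where F: "finite F" "F \<subseteq> rational_subbasis \<B> x y" "\<gamma> \<in> \<Inter>F"
    "path_space x y \<inter> \<Inter>F \<subseteq> a" by (elim exE conjE)
  from Int.IH(2)[OF \<open>\<gamma> \<in> b\<close>] obtain G where G: "finite G" "G \<subseteq> rational_subbasis \<B> x y" "\<gamma> \<in> \<Inter>G"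
    "path_space x y \<inter> \<Inter>G \<subseteq> b" by (elim exE conjE)
  show ?case
  proof (intro exI conjI)
    show "path_space x y \<inter> \<Inter>(F \<union> G) \<subseteq> a \<inter> b" using F(4) G(4) by auto
  qed (use F G in auto)
next
  case (UN K)
  then obtain k where k: "k \<in> K" "\<gamma> \<in> k" by blast
  from UN.IH[OF this] obtain F where F: "finite F" "F \<subseteq> rational_subbasis \<B> x y" "\<gamma> \<in> \<Inter>F"
    "path_space x y \<inter> \<Inter>F \<subseteq> k" by (elim exE conjE)
  show ?case
  proof (intro exI conjI)
    show "path_space x y \<inter> \<Inter>F \<subseteq> \<Union>K" using F(4) k(1) by blast
  qed (fact F)+
next
  case (Basis s)
  then obtain K U where s: "s = {\<gamma> \<in> path_space x y. \<gamma> ` K \<subseteq> U}" "K \<subseteq> {0..1}" "compact K" "open U" by blast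
  have \<gamma>: "\<gamma> \<in> path_space x y" "\<gamma> ` K \<subseteq> U" using Basis.prems unfolding s(1) by simp_all
  show ?case
    unfolding s(1) by (rule rational_subbasis_refines[OF \<B> \<gamma>(1) s(3,2,4) \<gamma>(2)])
qed

text \<open>For a path \<open>\<gamma>\<close>, the compact set \<open>\<gamma> ` K\<close> lies in \<open>U\<close> iff it lies in a finite union of closures of
  basic open sets contained in \<open>U\<close>; for such a closed union it suffices to test a countable dense
  subset of \<open>K\<close>.\<close>

lemma measurable_image_subset:
  fixes h :: "'z \<Rightarrow> real \<Rightarrow> 'm::second_countable_topology"
  assumes reg: "regular_space (euclidean :: 'm topology)"
    and cont: "\<And>z. z \<in> space Z \<Longrightarrow> continuous_on K (h z)"
    and meas: "\<And>t. t \<in> K \<Longrightarrow> (\<lambda>z. h z t) \<in> borel_measurable Z"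
    and K: "compact K" and U: "open U"
  shows "{z \<in> space Z. h z ` K \<subseteq> U} \<in> sets Z"
proof -
  obtain \<B> :: "'m set set" where \<B>: "countable \<B>" "topological_basis \<B>" by (metis ex_countable_basis)
  obtain T where T: "countable T" "T \<subseteq> K" "K \<subseteq> closure T" by (rule separable[of K])
  define \<C> where "\<C> = {C \<in> \<B>. closure C \<subseteq> U}"
  have \<C>: "\<exists>C\<in>\<C>. a \<in> C" if "a \<in> U" for a
  proof -
    have "closedin euclidean (- U) \<and> a \<in> topspace euclidean - (- U)" using U that by (simp add: closed_Compl)
    then obtain V where V: "open V" "a \<in> V" "disjnt (- U) (closure V)"
      using reg unfolding regular_space by (metis open_openin euclidean_closure_of)
    obtain C where "C \<in> \<B>" "a \<in> C" "C \<subseteq> V" using topological_basisE[OF \<B>(2) V(1,2)] .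
    then have "closure C \<subseteq> U" using closure_mono[of C V] V(3) by (auto simp: disjnt_iff)
    then show ?thesis using \<open>C \<in> \<B>\<close> \<open>a \<in> C\<close> by (auto simp: \<C>_def)
  qed
  let ?D = "{F. finite F \<and> F \<subseteq> \<C>}"
  have "countable ?D" using \<B>(1) by (intro countable_Collect_finite_subset) (auto simp: \<C>_def)
  have iff: "h z ` K \<subseteq> U \<longleftrightarrow> (\<exists>F\<in>?D. \<forall>t\<in>T. h z t \<in> (\<Union>C\<in>F. closure C))" if z: "z \<in> space Z" for z
  proof
    assume sub: "h z ` K \<subseteq> U"
    have "compact (h z ` K)" using cont[OF z] K compact_continuous_image by blast
    moreover have "h z ` K \<subseteq> \<Union>\<C>" using sub \<C> by blast
    moreover have "open C" if "C \<in> \<C>" for C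
      using that topological_basis_open[OF \<B>(2)] by (simp add: \<C>_def)
    ultimately obtain F where F: "F \<subseteq> \<C>" "finite F" "h z ` K \<subseteq> \<Union>F"
      by (rule compactE)
    have "h z t \<in> (\<Union>C\<in>F. closure C)" if t: "t \<in> T" for t
    proof -
      have "h z t \<in> \<Union>F" using F(3) T(2) t by blast
      then obtain C where "C \<in> F" "h z t \<in> C" by (rule UnionE)
      then show ?thesis using closure_subset[of C] by (intro UN_I[of C]) auto
    qed
    with F(1,2) show "\<exists>F\<in>?D. \<forall>t\<in>T. h z t \<in> (\<Union>C\<in>F. closure C)" by (intro bexI[of _ F]) simp_all
  next
    assume "\<exists>F\<in>?D. \<forall>t\<in>T. h z t \<in> (\<Union>C\<in>F. closure C)"
    then obtain F where F: "finite F" "F \<subseteq> \<C>" "\<forall>t\<in>T. h z t \<in> (\<Union>C\<in>F. closure C)" by auto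
    have cl: "closed (\<Union>C\<in>F. closure C)" using F(1) by auto
    have "closed (K \<inter> h z -` (\<Union>C\<in>F. closure C))"
      by (rule continuous_closed_preimage[OF cont[OF z] compact_imp_closed[OF K] cl])
    then have "closure T \<subseteq> K \<inter> h z -` (\<Union>C\<in>F. closure C)"
      by (rule closure_minimal[rotated]) (use F(3) T(2) in auto)
    then have "h z ` K \<subseteq> (\<Union>C\<in>F. closure C)" using T(3) by blast
    also have "\<dots> \<subseteq> U" using F(2) by (auto simp: \<C>_def)
    finally show "h z ` K \<subseteq> U" .
  qed
  have "{z \<in> space Z. h z t \<in> (\<Union>C\<in>F. closure C)} \<in> sets Z" if "F \<in> ?D" "t \<in> T" for F t
  proof -
    have "(\<lambda>z. h z t) -` (\<Union>C\<in>F. closure C) \<inter> space Z \<in> sets Z"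
      using meas[of t] that T(2) by (intro measurable_sets[where A=borel] borel_closed) auto
    moreover have "(\<lambda>z. h z t) -` (\<Union>C\<in>F. closure C) \<inter> space Z = {z \<in> space Z. h z t \<in> (\<Union>C\<in>F. closure C)}" by auto
    ultimately show ?thesis by simp
  qed
  then have "{z \<in> space Z. \<exists>F\<in>?D. \<forall>t\<in>T. h z t \<in> (\<Union>C\<in>F. closure C)} \<in> sets Z"
    by (intro sets.sets_Collect_countable_Ex' sets.sets_Collect_countable_All' T(1) \<open>countable ?D\<close>)
  then show ?thesis using iff by (simp only: cong: conj_cong)
qed

text \<open>This is the form in which the evaluations generate the Borel sets of paths: an open set
  is a countable union of finite intersections of rational subbasic sets, and each of those has a
  measurable preimage by \<open>measurable_image_subset\<close>. The source \<open>Z\<close> is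
  arbitrary, so the lemma serves both the interpolation map and the universal property.\<close>

lemma measurable_into_path_borel:
  fixes h :: "'z \<Rightarrow> real \<Rightarrow> 'm::second_countable_topology"
  assumes reg: "regular_space (euclidean :: 'm topology)"
    and h: "h \<in> space Z \<rightarrow> path_space x y"
    and meas: "\<And>t. t \<in> {0..1} \<Longrightarrow> (\<lambda>z. h z t) \<in> borel_measurable Z"
  shows "h \<in> measurable Z (path_borel x y)"
  unfolding path_borel_def
proof (rule measurable_measure_of)
  show "{W. openin (compact_open x y) W} \<subseteq> Pow (path_space x y)"
    using openin_subset[of "compact_open x y"] by (auto simp: topspace_compact_open)
  show "h \<in> space Z \<rightarrow> path_space x y" by fact
  obtain \<B> :: "'m set set" where \<B>: "countable \<B>" "topological_basis \<B>" by (metis ex_countable_basis)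
  have sub: "{z \<in> space Z. h z \<in> C} \<in> sets Z" if "C \<in> rational_subbasis \<B> x y" for C
  proof -
    obtain p q B where C: "C = {\<gamma> \<in> path_space x y. \<gamma> ` ({p..q} \<inter> {0..1}) \<subseteq> B}" "B \<in> \<B>"
      using \<open>C \<in> rational_subbasis \<B> x y\<close> by (auto simp: rational_subbasis_def)
    have "{z \<in> space Z. h z ` ({p..q} \<inter> {0..1}) \<subseteq> B} \<in> sets Z"
    proof (rule measurable_image_subset[OF reg])
      show "continuous_on ({p..q} \<inter> {0..1}) (h z)" if "z \<in> space Z" for z
      proof (rule continuous_on_subset)
        show "continuous_on {0..1} (h z)" using h that by (auto simp: path_space_def)
      qed simp
      show "(\<lambda>z. h z t) \<in> borel_measurable Z" if "t \<in> {p..q} \<inter> {0..1}" for t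
        using meas[of t] that by simp
      show "compact ({p..q} \<inter> {0..1})" by (intro compact_Int compact_Icc)
      show "open B" using \<B>(2) C(2) by (rule topological_basis_open)
    qed
    moreover have "{z \<in> space Z. h z \<in> C} = {z \<in> space Z. h z ` ({p..q} \<inter> {0..1}) \<subseteq> B}"
      unfolding C(1) using h by blast
    ultimately show ?thesis by simp
  qed
  fix W assume "W \<in> {W. openin (compact_open x y) W}"
  then have W: "openin (compact_open x y) W" by simp
  let ?D = "{F. finite F \<and> F \<subseteq> rational_subbasis \<B> x y}"
  have "countable ?D" by (intro countable_Collect_finite_subset countable_rational_subbasis \<B>)
  then have D: "countable {F \<in> ?D. path_space x y \<inter> \<Inter>F \<subseteq> W}" by (rule countable_subset[rotated]) auto
  have iff: "h z \<in> W \<longleftrightarrow> (\<exists>F\<in>{F \<in> ?D. path_space x y \<inter> \<Inter>F \<subseteq> W}. \<forall>C\<in>F. h z \<in> C)" if z: "z \<in> space Z" for z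
  proof
    assume "h z \<in> W"
    then obtain F where "finite F" "F \<subseteq> rational_subbasis \<B> x y" "h z \<in> \<Inter>F" "path_space x y \<inter> \<Inter>F \<subseteq> W"
      using compact_open_rational_subbasis[OF \<B>(2) W, of "h z"] by blast
    then show "\<exists>F\<in>{F \<in> ?D. path_space x y \<inter> \<Inter>F \<subseteq> W}. \<forall>C\<in>F. h z \<in> C"
      by (intro bexI[of _ F]) simp_all
  next
    assume "\<exists>F\<in>{F \<in> ?D. path_space x y \<inter> \<Inter>F \<subseteq> W}. \<forall>C\<in>F. h z \<in> C"
    then obtain F where F: "F \<in> {F \<in> ?D. path_space x y \<inter> \<Inter>F \<subseteq> W}" "\<forall>C\<in>F. h z \<in> C" by (rule bexE)
    have "h z \<in> path_space x y \<inter> \<Inter>F" using h z F(2) by auto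
    moreover have "path_space x y \<inter> \<Inter>F \<subseteq> W" using F(1) by simp
    ultimately show "h z \<in> W" by (rule subsetD[rotated])
  qed
  have "{z \<in> space Z. \<exists>F\<in>{F \<in> ?D. path_space x y \<inter> \<Inter>F \<subseteq> W}. \<forall>C\<in>F. h z \<in> C} \<in> sets Z"
    by (intro sets.sets_Collect_countable_Ex' sets.sets_Collect_countable_All' D sub) (auto intro: countable_finite)
  moreover have "h -` W \<inter> space Z = {z \<in> space Z. h z \<in> W}" by auto
  ultimately show "h -` W \<inter> space Z \<in> sets Z" using iff by (simp only: cong: conj_cong)
qed

section \<open>Interpolation of paths and bases of cylinder sets\<close>

text \<open>Beyond the last time the path stays constant. Before the first time
  \<open>\<sigma>\<close> would be evaluated outside the unit interval, hence the restriction to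
  times from the head of the list onwards in the facts below.\<close>

fun glue :: "('m \<Rightarrow> 'm \<Rightarrow> real \<Rightarrow> 'm) \<Rightarrow> real list \<Rightarrow> (real \<Rightarrow> 'm) \<Rightarrow> real \<Rightarrow> 'm" where
  "glue \<sigma> (a # b # ts) \<eta> t = (if t \<le> b then \<sigma> (\<eta> a) (\<eta> b) ((t - a) / (b - a)) else glue \<sigma> (b # ts) \<eta> t)"
| "glue \<sigma> [a] \<eta> t = \<eta> a"
| "glue \<sigma> [] \<eta> t = undefined"

lemma glue_at:
  assumes "\<And>a b. \<sigma> a b 0 = a" "\<And>a b. \<sigma> a b 1 = b"
  shows "sorted_wrt (<) ts \<Longrightarrow> u \<in> set ts \<Longrightarrow> glue \<sigma> ts \<eta> u = \<eta> u"
  using assms by (induction ts rule: induct_list012) auto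

text \<open>At \<open>b\<close> the left piece ends in \<open>\<eta> b\<close> and the rest starts
  there by \<open>glue_at\<close>, so the two closed pieces paste. The constant tail lets the
  induction run over half-lines.\<close>

lemma continuous_on_glue:
  assumes \<sigma>: "\<And>a b. continuous_on {0..1} (\<sigma> a b)" "\<And>a b. \<sigma> a b 0 = a" "\<And>a b. \<sigma> a b 1 = b"
  shows "sorted_wrt (<) (a # ts) \<Longrightarrow> continuous_on {a..} (glue \<sigma> (a # ts) \<eta>)"
proof (induction ts arbitrary: a)
  case Nil
  then show ?case by simp
next
  case (Cons b ts)
  then have ab: "a < b" and cont: "continuous_on {b..} (glue \<sigma> (b # ts) \<eta>)" by auto
  have "continuous_on {a..b} (\<lambda>t. \<sigma> (\<eta> a) (\<eta> b) ((t - a) / (b - a)))"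
    by (rule continuous_on_compose2[OF \<sigma>(1)]) (use ab in \<open>auto intro!: continuous_intros simp: divide_simps\<close>)
  then have "continuous_on ({a..b} \<union> {b..})
    (\<lambda>t. if t \<le> b then \<sigma> (\<eta> a) (\<eta> b) ((t - a) / (b - a)) else glue \<sigma> (b # ts) \<eta> t)"
    using ab \<sigma>(3) Cons.prems glue_at[OF \<sigma>(2,3), of "b # ts" b]
    by (intro continuous_on_cases cont) auto
  moreover have "{a..b} \<union> {b..} = {a..}" using ab by auto
  ultimately show ?case by (simp cong: if_cong)
qed

text \<open>At fixed \<open>t\<close> the branch taken does not depend on \<open>z\<close>; the
  value is one evaluation of \<open>\<sigma>\<close> at two measurable coordinates, or a coordinate
  itself.\<close>

lemma borel_measurable_glue:
  fixes \<sigma> :: "'m \<Rightarrow> 'm \<Rightarrow> real \<Rightarrow> 'm::second_countable_topology"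
  assumes \<sigma>: "\<And>t. t \<in> {0..1} \<Longrightarrow> (\<lambda>(a, b). \<sigma> a b t) \<in> borel_measurable borel"
  shows "sorted_wrt (<) (a # ts) \<Longrightarrow> t \<ge> a \<Longrightarrow> (\<And>u. u \<in> set (a # ts) \<Longrightarrow> (\<lambda>z. \<eta> z u) \<in> borel_measurable Z) \<Longrightarrow>
    (\<lambda>z. glue \<sigma> (a # ts) (\<eta> z) t) \<in> borel_measurable Z"
proof (induction ts arbitrary: a)
  case (Cons b ts)
  show ?case
  proof (cases "t \<le> b")
    case True
    have "(t - a) / (b - a) \<in> {0..1}" using Cons.prems True by (auto simp: divide_simps)
    from measurable_compose[OF borel_measurable_Pair \<sigma>[OF this], of "\<lambda>z. \<eta> z a" Z "\<lambda>z. \<eta> z b"]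
    show ?thesis using True Cons.prems by simp
  next
    case False
    then show ?thesis using Cons by simp
  qed
qed simp

text \<open>The map \<open>s\<close> is a Borel right inverse of the evaluation at the interior
  times of \<open>D\<close>.\<close>

lemma path_interpolation:
  fixes x y :: "'m::{t2_space, second_countable_topology}"
  assumes "locally_euclidean TYPE('m::{t2_space, second_countable_topology})"
    and "connected (UNIV :: 'm::{t2_space, second_countable_topology} set)"
    and D: "D \<in> time_partitions"
  obtains s :: "(real \<Rightarrow> 'm) \<Rightarrow> real \<Rightarrow> 'm" where "\<And>\<eta>. s \<eta> \<in> path_space x y" "\<And>\<eta> t. t \<in> D - {0, 1} \<Longrightarrow> s \<eta> t = \<eta> t"
    "s \<in> measurable (PiM (D - {0, 1}) (\<lambda>_. borel)) (path_borel x y)"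
proof -
  from assms(1,2) obtain \<sigma> :: "'m \<Rightarrow> 'm \<Rightarrow> real \<Rightarrow> 'm"
    where \<sigma>: "\<And>a b. continuous_on {0..1} (\<sigma> a b)" "\<And>a b. \<sigma> a b 0 = a" "\<And>a b. \<sigma> a b 1 = b"
      and meas: "\<And>t. t \<in> {0..1} \<Longrightarrow> (\<lambda>(a, b). \<sigma> a b t) \<in> borel_measurable borel"
    by (rule borel_path_selection) blast
  have fin: "finite D" and sub: "D \<subseteq> {0..1}" and in01: "0 \<in> D" "1 \<in> D" using D by (auto simp: time_partitions_def)
  have Min: "Min D = 0" using fin sub in01 by (intro Min_eqI) auto
  define ts where "ts = sorted_list_of_set (D - {0})"
  have L: "sorted_list_of_set D = 0 # ts"
    unfolding ts_def using sorted_list_of_set_nonempty[OF fin] in01 Min by auto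
  have sorted: "sorted_wrt (<) (0 # ts)" unfolding L[symmetric] by simp
  have setL: "set (0 # ts) = D" unfolding L[symmetric] using fin by simp
  \<comment> \<open>The endpoint values are overwritten instead of being required of
    \<open>\<eta>\<close>, so \<open>\<eta>\<close> may range over the full product over the
    interior times.\<close>
  define s where "s \<eta> = restrict (glue \<sigma> (0 # ts) (\<eta>(0 := x, 1 := y))) {0..1}" for \<eta>
  have at: "s \<eta> t = (\<eta>(0 := x, 1 := y)) t" if "t \<in> D" for \<eta> t
    using that sub glue_at[OF \<sigma>(2,3) sorted, of t] setL unfolding s_def by auto
  have path: "s \<eta> \<in> path_space x y" for \<eta>
    unfolding path_space_def
  proof (intro CollectI conjI)
    show "s \<eta> \<in> extensional {0..1}" by (simp add: s_def)
    have "continuous_on {0..1} (glue \<sigma> (0 # ts) (\<eta>(0 := x, 1 := y)))"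
      using continuous_on_glue[OF \<sigma> sorted] by (rule continuous_on_subset) auto
    then show "continuous_on {0..1} (s \<eta>)" unfolding s_def by (simp cong: continuous_on_cong_simp)
    show "s \<eta> 0 = x" "s \<eta> 1 = y" using in01 by (simp_all add: at)
  qed
  show thesis
  proof (rule that[of s])
    show "s \<eta> t = \<eta> t" if "t \<in> D - {0, 1}" for \<eta> t using that by (simp add: at)
    show "s \<in> measurable (PiM (D - {0, 1}) (\<lambda>_. borel)) (path_borel x y)"
    proof (rule measurable_into_path_borel[OF locally_euclidean_imp_regular[OF assms(1)]])
      fix t :: real assume t: "t \<in> {0..1}"
      have "(\<lambda>\<eta>. glue \<sigma> (0 # ts) (\<eta>(0 := x, 1 := y)) t) \<in> borel_measurable (PiM (D - {0, 1}) (\<lambda>_. borel))"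
      proof (rule borel_measurable_glue[OF meas sorted])
        fix u assume "u \<in> set (0 # ts)"
        then consider "u = 0" | "u = 1" | "u \<in> D - {0, 1}" unfolding setL by blast
        then show "(\<lambda>\<eta>. (\<eta>(0 := x, 1 := y)) u) \<in> borel_measurable (PiM (D - {0, 1}) (\<lambda>_. borel))"
          by cases (simp_all add: measurable_component_singleton)
      qed (use t in auto)
      then show "(\<lambda>\<eta>. s \<eta> t) \<in> borel_measurable (PiM (D - {0, 1}) (\<lambda>_. borel))"
        using t by (simp add: s_def)
    qed (use path in blast)
  qed (rule path)
qed

text \<open>The image of \<open>A\<close> under evaluation, with coordinates labelled by the times.
  Refining the partition adds coordinates without renumbering the old ones.\<close>

definition cyl_base :: "real set \<Rightarrow> (real \<Rightarrow> 'm) set \<Rightarrow> (real \<Rightarrow> 'm) set" where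
  "cyl_base D A = (\<lambda>\<gamma>. restrict \<gamma> (D - {0, 1})) ` A"

lemma path_cyl_sets_subset: "A \<in> path_cyl_sets x y D \<Longrightarrow> A \<subseteq> path_space x y"
  using sets.sets_into_space[of A "path_cyl x y D"] by (simp add: sets_path_cyl space_path_cyl)

lemma path_cyl_sets_mono: "D \<subseteq> D' \<Longrightarrow> path_cyl_sets x y D \<subseteq> path_cyl_sets x y D'"
proof
  fix A assume "D \<subseteq> D'" and A: "A \<in> path_cyl_sets x y D"
  then have "restrict \<gamma>\<^sub>1 D = restrict \<gamma>\<^sub>2 D" if "restrict \<gamma>\<^sub>1 D' = restrict \<gamma>\<^sub>2 D'" for \<gamma>\<^sub>1 \<gamma>\<^sub>2 :: "real \<Rightarrow> 'a"
    using that by (metis restrict_restrict inf.absorb2)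
  with A show "A \<in> path_cyl_sets x y D'" unfolding path_cyl_sets_def by blast
qed

text \<open>Agreement at 0 and 1 is automatic, since all paths share their endpoints; this is why
  interior times suffice as coordinates.\<close>

lemma path_cyl_sets_congD:
  assumes "A \<in> path_cyl_sets x y D" "\<gamma>\<^sub>1 \<in> A" "\<gamma>\<^sub>2 \<in> path_space x y" "\<And>t. t \<in> D - {0, 1} \<Longrightarrow> \<gamma>\<^sub>1 t = \<gamma>\<^sub>2 t"
  shows "\<gamma>\<^sub>2 \<in> A"
proof -
  have p: "\<gamma>\<^sub>1 \<in> path_space x y" using assms(1,2) path_cyl_sets_subset by blast
  have "restrict \<gamma>\<^sub>1 D = restrict \<gamma>\<^sub>2 D"
  proof
    fix t show "restrict \<gamma>\<^sub>1 D t = restrict \<gamma>\<^sub>2 D t"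
      using assms(3,4) p by (cases "t = 0 \<or> t = 1") (auto simp: path_space_def restrict_def)
  qed
  with assms(1-3) p show ?thesis unfolding path_cyl_sets_def by blast
qed

context
  fixes x y :: "'m::{t2_space, second_countable_topology}"
  assumes M: "locally_euclidean TYPE('m)" "connected (UNIV :: 'm set)"
begin

text \<open>A cylinder set is saturated: it is a union of fibres of the evaluation, so no
  information is lost in passing to the base.\<close>

lemma cyl_base_iff:
  assumes A: "A \<in> path_cyl_sets x y D" and "D \<in> time_partitions" and \<gamma>: "\<gamma> \<in> path_space x y"
  shows "restrict \<gamma> (D - {0, 1}) \<in> cyl_base D A \<longleftrightarrow> \<gamma> \<in> A"
proof
  assume "restrict \<gamma> (D - {0, 1}) \<in> cyl_base D A"
  then obtain \<gamma>' where \<gamma>': "\<gamma>' \<in> A" "restrict \<gamma> (D - {0, 1}) = restrict \<gamma>' (D - {0, 1})" by (auto simp: cyl_base_def)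
  have "\<gamma>' t = \<gamma> t" if "t \<in> D - {0, 1}" for t using fun_cong[OF \<gamma>'(2), of t] that by simp
  then show "\<gamma> \<in> A" using path_cyl_sets_congD[OF A \<gamma>'(1) \<gamma>] by blast
qed (auto simp: cyl_base_def)

lemma cyl_base_measurable:
  assumes A: "A \<in> path_cyl_sets x y D" and D: "D \<in> time_partitions"
  shows "cyl_base D A \<in> sets (PiM (D - {0, 1}) (\<lambda>_. borel))"
proof -
  obtain s :: "(real \<Rightarrow> 'm) \<Rightarrow> real \<Rightarrow> 'm" where s: "\<And>\<eta>. s \<eta> \<in> path_space x y" "\<And>\<eta> t. t \<in> D - {0, 1} \<Longrightarrow> s \<eta> t = \<eta> t"
    and meas: "s \<in> measurable (PiM (D - {0, 1}) (\<lambda>_. borel)) (path_borel x y)"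
    by (rule path_interpolation[OF M D, of x y]) blast
  have "restrict (s \<eta>) (D - {0, 1}) = \<eta>" if "\<eta> \<in> extensional (D - {0, 1})" for \<eta>
    using that s(2) by (auto simp: extensional_def restrict_def)
  then have "s \<eta> \<in> A \<longleftrightarrow> \<eta> \<in> cyl_base D A" if "\<eta> \<in> extensional (D - {0, 1})" for \<eta>
    using cyl_base_iff[OF A D s(1), of \<eta>] that by simp
  moreover have "cyl_base D A \<subseteq> extensional (D - {0, 1})" by (auto simp: cyl_base_def)
  ultimately have "cyl_base D A = s -` A \<inter> space (PiM (D - {0, 1}) (\<lambda>_. borel))"
    by (auto simp: space_PiM PiE_def)
  then show ?thesis
    using measurable_sets[OF meas] A by (simp add: path_cyl_sets_def)
qed

text \<open>Any \<open>\<eta>\<close> on the finer partition is interpolated by a path, and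
  membership of that path in \<open>A\<close> can be read off at either partition. The implication
  from right to left depends on the existence of this path.\<close>

lemma cyl_base_refine:
  assumes A: "A \<in> path_cyl_sets x y D" and D: "D \<in> time_partitions" "D' \<in> time_partitions" "D \<subseteq> D'"
    and \<eta>: "\<eta> \<in> extensional (D' - {0, 1})"
  shows "\<eta> \<in> cyl_base D' A \<longleftrightarrow> restrict \<eta> (D - {0, 1}) \<in> cyl_base D A"
proof -
  obtain s :: "(real \<Rightarrow> 'm) \<Rightarrow> real \<Rightarrow> 'm" where s: "\<And>\<eta>. s \<eta> \<in> path_space x y" "\<And>\<eta> t. t \<in> D' - {0, 1} \<Longrightarrow> s \<eta> t = \<eta> t"
    by (rule path_interpolation[OF M D(2), of x y]) blast
  have "restrict (s \<eta>) (D' - {0, 1}) = \<eta>" "restrict (s \<eta>) (D - {0, 1}) = restrict \<eta> (D - {0, 1})"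
    using \<eta> s(2)[of _ \<eta>] D(3) by (auto simp: extensional_def restrict_def fun_eq_iff)
  moreover have "A \<in> path_cyl_sets x y D'" using A path_cyl_sets_mono[OF D(3)] by blast
  ultimately show ?thesis
    using cyl_base_iff[OF A D(1) s(1)[of \<eta>]] cyl_base_iff[OF _ D(2) s(1)[of \<eta>], of A] by simp
qed

text \<open>Images of disjoint sets may meet; saturation excludes this for cylinder sets.\<close>

lemma cyl_base_disjoint:
  assumes "A \<in> path_cyl_sets x y D" "B \<in> path_cyl_sets x y D" "D \<in> time_partitions" "A \<inter> B = {}"
  shows "cyl_base D A \<inter> cyl_base D B = {}"
proof -
  have "\<gamma> \<in> B" if "\<gamma> \<in> A" "restrict \<gamma> (D - {0, 1}) \<in> cyl_base D B" for \<gamma>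
    using cyl_base_iff[OF assms(2,3), of \<gamma>] that path_cyl_sets_subset[OF assms(1)] by blast
  then show ?thesis using assms(4) by (auto simp: cyl_base_def)
qed

end

section \<open>Scalar coordinates on a Hermitian line bundle\<close>

text \<open>The coordinate belonging to a choice of one unit vector in each fibre;
  \<open>herm\<close> expresses the normalization. Continuity is deliberately absent, because a
  nontrivial bundle has no global continuous unit section.\<close>

locale scalar_coordinate =
  fixes L :: "('m, 'l) line_bundle" and \<kappa> :: "'l \<Rightarrow> complex"
  assumes add_closed: "u \<in> fibre L x \<Longrightarrow> v \<in> fibre L x \<Longrightarrow> badd L u v \<in> fibre L x"
    and scale_closed: "u \<in> fibre L x \<Longrightarrow> bscale L c u \<in> fibre L x"
    and bij: "bij_betw \<kappa> (fibre L x) UNIV"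
    and add: "u \<in> fibre L x \<Longrightarrow> v \<in> fibre L x \<Longrightarrow> \<kappa> (badd L u v) = \<kappa> u + \<kappa> v"
    and scale: "u \<in> fibre L x \<Longrightarrow> \<kappa> (bscale L c u) = c * \<kappa> u"
    and herm: "u \<in> fibre L x \<Longrightarrow> v \<in> fibre L x \<Longrightarrow> bherm L u v = \<kappa> u * cnj (\<kappa> v)"
begin

definition vec :: "'m \<Rightarrow> complex \<Rightarrow> 'l" where
  "vec x c = the_inv_into (fibre L x) \<kappa> c"

text \<open>The one-by-one matrix of \<open>T\<close> in the unit frames. The target fibre is no
  argument because \<open>\<kappa>\<close> is defined on the whole total space.\<close>

definition coeff :: "'m \<Rightarrow> ('l \<Rightarrow> 'l) \<Rightarrow> complex" where
  "coeff x T = \<kappa> (T (vec x 1))"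

definition hom_of_coeff :: "'m \<Rightarrow> 'm \<Rightarrow> complex \<Rightarrow> 'l \<Rightarrow> 'l" where
  "hom_of_coeff x y c = (\<lambda>u\<in>fibre L x. vec y (c * \<kappa> u))"

lemma vec: "vec x c \<in> fibre L x" "\<kappa> (vec x c) = c"
  using bij[of x] by (auto simp: vec_def bij_betw_def the_inv_into_into f_the_inv_into_f)

lemma vec_eqI: "u \<in> fibre L x \<Longrightarrow> v \<in> fibre L x \<Longrightarrow> \<kappa> u = \<kappa> v \<Longrightarrow> u = v"
  using bij[of x] by (auto simp: bij_betw_def inj_on_def)

lemma hom_in_fibre: "T \<in> fibre_hom L x y \<Longrightarrow> u \<in> fibre L x \<Longrightarrow> T u \<in> fibre L y"
  by (auto simp: fibre_hom_def)

lemma coeff: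
  assumes T: "T \<in> fibre_hom L x y" and u: "u \<in> fibre L x"
  shows "\<kappa> (T u) = coeff x T * \<kappa> u"
proof -
  have "u = bscale L (\<kappa> u) (vec x 1)"
    by (rule vec_eqI[OF u]) (simp_all add: scale_closed vec scale[OF vec(1)])
  then have "T u = bscale L (\<kappa> u) (T (vec x 1))"
    using T vec(1)[of x 1] unfolding fibre_hom_def by (metis (mono_tags, lifting) mem_Collect_eq)
  then show ?thesis
    by (simp add: scale[OF hom_in_fibre[OF T vec(1)]] coeff_def)
qed

lemma hom_of_coeff: "hom_of_coeff x y c \<in> fibre_hom L x y" "coeff x (hom_of_coeff x y c) = c"
proof -
  have "vec y (c * (\<kappa> u + \<kappa> v)) = badd L (vec y (c * \<kappa> u)) (vec y (c * \<kappa> v))" for u v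
    by (rule vec_eqI[of _ y]) (simp_all add: vec add_closed add[OF vec(1) vec(1)] algebra_simps)
  moreover have "vec y (c * (d * \<kappa> u)) = bscale L d (vec y (c * \<kappa> u))" for u d
    by (rule vec_eqI[of _ y]) (simp_all add: vec scale_closed scale[OF vec(1)] algebra_simps)
  ultimately show "hom_of_coeff x y c \<in> fibre_hom L x y"
    unfolding fibre_hom_def hom_of_coeff_def
    by (simp add: vec(1) add_closed[of _ x] scale_closed[of _ x] add[of _ x] scale[of _ x])
  show "coeff x (hom_of_coeff x y c) = c"
    by (simp add: coeff_def hom_of_coeff_def vec)
qed

lemma hom_eqI:
  assumes "S \<in> fibre_hom L x y" "T \<in> fibre_hom L x y" "coeff x S = coeff x T"
  shows "S = T"
proof (rule ext)
  fix u show "S u = T u"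
  proof (cases "u \<in> fibre L x")
    case True
    then have "\<kappa> (S u) = \<kappa> (T u)"
      by (simp only: coeff[OF assms(1) True] coeff[OF assms(2) True] assms(3))
    then show ?thesis
      by (rule vec_eqI[OF hom_in_fibre[OF assms(1) True] hom_in_fibre[OF assms(2) True]])
  next
    case False
    moreover have "S \<in> extensional (fibre L x)" "T \<in> extensional (fibre L x)"
      using assms(1,2) by (simp_all add: fibre_hom_def PiE_def)
    ultimately show ?thesis by (simp add: extensional_def)
  qed
qed

lemma hom_mult:
  assumes "S \<in> fibre_hom L x y" "T \<in> fibre_hom L y z"
  shows "hom_mult L x S T \<in> fibre_hom L x z" "coeff x (hom_mult L x S T) = coeff x S * coeff y T"
proof -
  show "hom_mult L x S T \<in> fibre_hom L x z"
    using assms unfolding fibre_hom_def hom_mult_def compose_def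
    by (simp add: add_closed[of _ x] scale_closed[of _ x] PiE_iff)
  show "coeff x (hom_mult L x S T) = coeff x S * coeff y T"
    using coeff[OF assms(2) hom_in_fibre[OF assms(1) vec(1)]]
    by (simp add: coeff_def[of x] hom_mult_def compose_def vec)
qed

lemma fibre_norm: "u \<in> fibre L x \<Longrightarrow> fibre_norm L u = norm (\<kappa> u)"
  by (simp add: fibre_norm_def herm cmod_def power2_eq_square)

text \<open>In unit frames \<open>T\<close> is multiplication by \<open>coeff x T\<close>, and the
  supremum over the unit ball is attained at \<open>vec x 1\<close>.\<close>

lemma hom_norm:
  assumes T: "T \<in> fibre_hom L x y"
  shows "hom_norm L x T = norm (coeff x T)"
  unfolding hom_norm_def
proof (rule cSup_eq_maximum)
  have "fibre_norm L (T (vec x 1)) = norm (coeff x T)"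
    by (simp add: fibre_norm[OF hom_in_fibre[OF T vec(1)]] coeff_def)
  then show "norm (coeff x T) \<in> (\<lambda>u. fibre_norm L (T u)) ` {u \<in> fibre L x. fibre_norm L u \<le> 1}"
    by (intro image_eqI[of _ _ "vec x 1"]) (simp_all add: vec fibre_norm[OF vec(1)])
next
  fix r assume "r \<in> (\<lambda>u. fibre_norm L (T u)) ` {u \<in> fibre L x. fibre_norm L u \<le> 1}"
  then obtain u where u: "u \<in> fibre L x" "fibre_norm L u \<le> 1" "r = fibre_norm L (T u)" by blast
  then have "r = norm (coeff x T) * norm (\<kappa> u)" "norm (\<kappa> u) \<le> 1"
    by (simp_all add: fibre_norm[OF hom_in_fibre[OF T u(1)]] fibre_norm[OF u(1)] coeff[OF T u(1)] norm_mult)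
  then show "r \<le> norm (coeff x T)" by (simp add: mult_left_le)
qed

text \<open>All coordinates \<open>\<langle>T u, v\<rangle>\<close> are constant multiples of the
  single number \<open>coeff x T\<close>, and the unit vectors \<open>vec x 1\<close> and
  \<open>vec y 1\<close> recover that number itself. Hom-valued integrals thus become scalar
  ones.\<close>

lemma has_hom_integral_iff:
  "has_hom_integral L x y N S F T \<longleftrightarrow>
     S \<in> sets N \<and> (\<forall>z\<in>S. F z \<in> fibre_hom L x y) \<and> T \<in> fibre_hom L x y \<and>
     has_bochner_integral N (\<lambda>z. indicator S z *\<^sub>R coeff x (F z)) (coeff x T)"
proof -
  have eq: "indicator S z *\<^sub>R bherm L (F z u) v = indicator S z *\<^sub>R coeff x (F z) * (\<kappa> u * cnj (\<kappa> v))"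
    if "\<forall>z\<in>S. F z \<in> fibre_hom L x y" "u \<in> fibre L x" "v \<in> fibre L y" for u v z
    using that coeff[of "F z" x y u] hom_in_fibre[of "F z" x y u] herm[of "F z u" y v]
    by (cases "z \<in> S") auto
  have eqT: "bherm L (T u) v = coeff x T * (\<kappa> u * cnj (\<kappa> v))"
    if "T \<in> fibre_hom L x y" "u \<in> fibre L x" "v \<in> fibre L y" for u v
    using that coeff[of T x y u] hom_in_fibre[of T x y u] herm[of "T u" y v] by auto
  show ?thesis
  proof (intro iffI)
    assume H: "has_hom_integral L x y N S F T"
    have "has_bochner_integral N (\<lambda>z. indicator S z *\<^sub>R bherm L (F z (vec x 1)) (vec y 1)) (bherm L (T (vec x 1)) (vec y 1))"
      using H vec(1) by (simp add: has_hom_integral_def)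
    with H show "S \<in> sets N \<and> (\<forall>z\<in>S. F z \<in> fibre_hom L x y) \<and> T \<in> fibre_hom L x y \<and>
      has_bochner_integral N (\<lambda>z. indicator S z *\<^sub>R coeff x (F z)) (coeff x T)"
      using eq[OF _ vec(1) vec(1)] eqT[OF _ vec(1) vec(1)] by (simp add: has_hom_integral_def vec)
  next
    assume H: "S \<in> sets N \<and> (\<forall>z\<in>S. F z \<in> fibre_hom L x y) \<and> T \<in> fibre_hom L x y \<and>
      has_bochner_integral N (\<lambda>z. indicator S z *\<^sub>R coeff x (F z)) (coeff x T)"
    then have "has_bochner_integral N (\<lambda>z. indicator S z *\<^sub>R coeff x (F z) * (\<kappa> u * cnj (\<kappa> v))) (coeff x T * (\<kappa> u * cnj (\<kappa> v)))" for u v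
      by (intro has_bochner_integral_mult_left) simp
    with H show "has_hom_integral L x y N S F T"
      by (simp add: has_hom_integral_def eq eqT)
  qed
qed

text \<open>The description by \<open>THE\<close> is legitimate: integrability provides a solution
  through \<open>hom_of_coeff\<close>, and the coefficient determines a linear map.\<close>

lemma hom_integral:
  assumes S: "S \<in> sets N" and F: "\<And>z. z \<in> S \<Longrightarrow> F z \<in> fibre_hom L x y"
    and int: "integrable N (\<lambda>z. indicator S z *\<^sub>R coeff x (F z))"
  shows "has_hom_integral L x y N S F (hom_integral L x y N S F)"
    "coeff x (hom_integral L x y N S F) = (LINT z|N. indicator S z *\<^sub>R coeff x (F z))"
proof -
  let ?I = "LINT z|N. indicator S z *\<^sub>R coeff x (F z)"
  have *: "has_hom_integral L x y N S F (hom_of_coeff x y ?I)"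
    unfolding has_hom_integral_iff hom_of_coeff(2)
    using S F hom_of_coeff(1) has_bochner_integral_integrable[OF int] by blast
  have "T = hom_of_coeff x y ?I" if T: "has_hom_integral L x y N S F T" for T
  proof (rule hom_eqI)
    show "T \<in> fibre_hom L x y" using T by (simp add: has_hom_integral_def)
    have "has_bochner_integral N (\<lambda>z. indicator S z *\<^sub>R coeff x (F z)) (coeff x T)"
      using T unfolding has_hom_integral_iff by blast
    then show "coeff x T = coeff x (hom_of_coeff x y ?I)"
      unfolding hom_of_coeff(2) by (simp add: has_bochner_integral_integral_eq)
  qed (rule hom_of_coeff)
  then have eq: "hom_integral L x y N S F = hom_of_coeff x y ?I"
    unfolding hom_integral_def by (intro the_equality *)
  show "has_hom_integral L x y N S F (hom_integral L x y N S F)"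
    unfolding eq by (rule *)
  show "coeff x (hom_integral L x y N S F) = ?I"
    unfolding eq by (rule hom_of_coeff)
qed

end

section \<open>Unit frames from local trivializations\<close>

context
  fixes L :: "('m::topological_space, 'l::topological_space) line_bundle"
  assumes L: "hermitian_line_bundle L"
begin

lemma herm_add: "u \<in> fibre L x \<Longrightarrow> v \<in> fibre L x \<Longrightarrow> badd L u v \<in> fibre L x"
  and herm_scale: "u \<in> fibre L x \<Longrightarrow> bscale L c u \<in> fibre L x"
  and bherm_scale: "u \<in> fibre L x \<Longrightarrow> v \<in> fibre L x \<Longrightarrow> bherm L (bscale L c u) v = c * bherm L u v"
  and bherm_sym: "u \<in> fibre L x \<Longrightarrow> v \<in> fibre L x \<Longrightarrow> bherm L v u = cnj (bherm L u v)"
  and bherm_pos: "u \<noteq> bscale L 0 u \<Longrightarrow> Re (bherm L u u) > 0"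
  and bherm_cont: "continuous_on {(u, v). bproj L u = bproj L v} (\<lambda>(u, v). bherm L u v)"
  and ex_trivialization: "\<exists>U \<phi> \<psi>. x \<in> U \<and> local_trivialization L U \<phi> \<psi>"
proof -
  note * = L[unfolded hermitian_line_bundle_def]
  show "u \<in> fibre L x \<Longrightarrow> v \<in> fibre L x \<Longrightarrow> badd L u v \<in> fibre L x"
    using *[THEN conjunct1] by blast
  show "u \<in> fibre L x \<Longrightarrow> bscale L c u \<in> fibre L x"
    using *[THEN conjunct2, THEN conjunct1] by blast
  show "u \<in> fibre L x \<Longrightarrow> v \<in> fibre L x \<Longrightarrow> bherm L (bscale L c u) v = c * bherm L u v"
    using *[THEN conjunct2, THEN conjunct2, THEN conjunct2, THEN conjunct2, THEN conjunct1] by blast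
  show "u \<in> fibre L x \<Longrightarrow> v \<in> fibre L x \<Longrightarrow> bherm L v u = cnj (bherm L u v)"
    using *[THEN conjunct2, THEN conjunct2, THEN conjunct2, THEN conjunct2, THEN conjunct2, THEN conjunct1] by blast
  show "u \<noteq> bscale L 0 u \<Longrightarrow> Re (bherm L u u) > 0"
    using *[THEN conjunct2, THEN conjunct2, THEN conjunct2, THEN conjunct2, THEN conjunct2, THEN conjunct2, THEN conjunct1] by blast
  show "continuous_on {(u, v). bproj L u = bproj L v} (\<lambda>(u, v). bherm L u v)"
    using *[THEN conjunct2, THEN conjunct2, THEN conjunct2, THEN conjunct2, THEN conjunct2, THEN conjunct2, THEN conjunct2] by blast
  show "\<exists>U \<phi> \<psi>. x \<in> U \<and> local_trivialization L U \<phi> \<psi>"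
    using *[THEN conjunct2, THEN conjunct2, THEN conjunct1] by blast
qed

lemma trivialization:
  assumes T: "local_trivialization L U \<phi> \<psi>"
  shows "x \<in> U \<Longrightarrow> \<psi> (x, c) \<in> fibre L x" "x \<in> U \<Longrightarrow> \<phi> (\<psi> (x, c)) = (x, c)"
    "x \<in> U \<Longrightarrow> u \<in> fibre L x \<Longrightarrow> \<psi> (x, snd (\<phi> u)) = u"
    "x \<in> U \<Longrightarrow> u \<in> fibre L x \<Longrightarrow> v \<in> fibre L x \<Longrightarrow> snd (\<phi> (badd L u v)) = snd (\<phi> u) + snd (\<phi> v)"
    "x \<in> U \<Longrightarrow> u \<in> fibre L x \<Longrightarrow> snd (\<phi> (bscale L c u)) = c * snd (\<phi> u)"
    "open U" "continuous_on (U \<times> UNIV) \<psi>"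
proof -
  have h: "homeomorphism (bproj L -` U) (U \<times> UNIV) \<phi> \<psi>"
    and fst: "\<And>u. bproj L u \<in> U \<Longrightarrow> fst (\<phi> u) = bproj L u"
    using T unfolding local_trivialization_def by auto
  show "\<phi> (\<psi> (x, c)) = (x, c)" if "x \<in> U" for x c
    using that homeomorphism_apply2[OF h, of "(x, c)"] by simp
  note \<phi>\<psi> = this
  show "\<psi> (x, c) \<in> fibre L x" if "x \<in> U" for x c
  proof -
    have "\<psi> (x, c) \<in> bproj L -` U" using homeomorphism_image2[OF h] that by blast
    then show ?thesis using fst[of "\<psi> (x, c)"] \<phi>\<psi>[OF that] by (simp add: fibre_def)
  qed
  show "\<psi> (x, snd (\<phi> u)) = u" if "x \<in> U" "u \<in> fibre L x" for x u
    using that homeomorphism_apply1[OF h, of u] fst[of u] by (simp add: fibre_def) (metis prod.collapse)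
  show "x \<in> U \<Longrightarrow> u \<in> fibre L x \<Longrightarrow> v \<in> fibre L x \<Longrightarrow> snd (\<phi> (badd L u v)) = snd (\<phi> u) + snd (\<phi> v)"
    "x \<in> U \<Longrightarrow> u \<in> fibre L x \<Longrightarrow> snd (\<phi> (bscale L c u)) = c * snd (\<phi> u)"
    "open U" "continuous_on (U \<times> UNIV) \<psi>"
    using T h unfolding local_trivialization_def homeomorphism_def by blast+
qed

lemma trivialization_norm_pos:
  assumes T: "local_trivialization L U \<phi> \<psi>" and x: "x \<in> U"
  shows "fibre_norm L (\<psi> (x, 1)) > 0"
proof -
  have "snd (\<phi> (bscale L 0 (\<psi> (x, 1)))) = 0"
    using trivialization(5)[OF T x trivialization(1)[OF T x]] by simp
  moreover have "snd (\<phi> (\<psi> (x, 1))) = 1" using trivialization(2)[OF T x] by simp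
  ultimately have "\<psi> (x, 1) \<noteq> bscale L 0 (\<psi> (x, 1))" by (metis zero_neq_one)
  then show ?thesis using bherm_pos by (simp add: fibre_norm_def)
qed

text \<open>Both vectors are multiples of the frame vector \<open>\<psi> (x, 1)\<close>, so the
  metric is the product of the coordinates times its squared length. Giving one factor of the length
  to each argument yields the normalized coordinate.\<close>

lemma trivialization_herm:
  assumes T: "local_trivialization L U \<phi> \<psi>" and x: "x \<in> U" and u: "u \<in> fibre L x" and v: "v \<in> fibre L x"
  shows "bherm L u v = (snd (\<phi> u) * fibre_norm L (\<psi> (x, 1))) * cnj (snd (\<phi> v) * fibre_norm L (\<psi> (x, 1)))"
proof -
  let ?f = "\<psi> (x, 1)"
  have f: "?f \<in> fibre L x" by (rule trivialization(1)[OF T x])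
  have scaled: "w = bscale L (snd (\<phi> w)) ?f" if w: "w \<in> fibre L x" for w
  proof -
    have "snd (\<phi> (bscale L (snd (\<phi> w)) ?f)) = snd (\<phi> w)"
      using trivialization(5)[OF T x f] trivialization(2)[OF T x] by simp
    then show ?thesis
      using trivialization(3)[OF T x w] trivialization(3)[OF T x herm_scale[OF f]] by metis
  qed
  have left: "bherm L w w' = snd (\<phi> w) * bherm L ?f w'" if "w \<in> fibre L x" "w' \<in> fibre L x" for w w'
    using scaled[OF that(1)] bherm_scale[OF f that(2)] by metis
  have "bherm L ?f ?f = of_real (Re (bherm L ?f ?f))"
    using bherm_sym[OF f f] by (simp add: complex_eq_iff)
  also have "Re (bherm L ?f ?f) = (fibre_norm L ?f)\<^sup>2"
    using trivialization_norm_pos[OF T x] by (simp add: fibre_norm_def)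
  finally have ff: "bherm L ?f ?f = of_real ((fibre_norm L ?f)\<^sup>2)" .
  have "bherm L u v = snd (\<phi> u) * cnj (snd (\<phi> v) * bherm L ?f ?f)"
    using left[OF u v] left[OF v f] bherm_sym[OF v f] by simp
  then show ?thesis by (simp add: ff power2_eq_square)
qed

lemma continuous_on_trivialization_norm:
  assumes T: "local_trivialization L U \<phi> \<psi>"
  shows "continuous_on U (\<lambda>x. fibre_norm L (\<psi> (x, 1)))"
proof -
  have "continuous_on U (\<lambda>x. \<psi> (x, 1))"
    by (rule continuous_on_compose2[OF trivialization(7)[OF T]]) (auto intro!: continuous_intros)
  then have "continuous_on U (\<lambda>x. case (\<psi> (x, 1), \<psi> (x, 1)) of (u, v) \<Rightarrow> bherm L u v)"
    by (intro continuous_on_compose2[OF bherm_cont]) (auto intro!: continuous_intros)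
  then show ?thesis unfolding fibre_norm_def by (auto intro!: continuous_intros)
qed

lemma trivialization_fibre_norm:
  assumes "local_trivialization L U \<phi> \<psi>" "x \<in> U" "u \<in> fibre L x"
  shows "fibre_norm L u = norm (snd (\<phi> u)) * fibre_norm L (\<psi> (x, 1))"
proof -
  let ?c = "snd (\<phi> u) * complex_of_real (fibre_norm L (\<psi> (x, 1)))"
  have "Re (bherm L u u) = (norm ?c)\<^sup>2"
    unfolding trivialization_herm[OF assms assms(3)]
    unfolding complex_norm_square[symmetric] by simp
  then show ?thesis
    using trivialization_norm_pos[OF assms(1,2)] by (simp add: fibre_norm_def[of L u] norm_mult)
qed

end

lemma hermitian_scalar_coordinate:
  fixes L :: "('m::second_countable_topology, 'l::topological_space) line_bundle"
  assumes L: "hermitian_line_bundle L"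
  obtains \<kappa> where "scalar_coordinate L \<kappa>"
    "\<And>\<Omega>. continuous_hom_section L \<Omega> \<Longrightarrow>
      (\<lambda>(x, y). scalar_coordinate.coeff L \<kappa> x (\<Omega> x y)) \<in> borel_measurable borel"
proof -
  have "\<exists>U. open U \<and> p \<in> U \<and> (\<exists>\<phi> \<psi>. local_trivialization L U \<phi> \<psi>)" for p
    using ex_trivialization[OF L, of p] trivialization(6)[OF L] by blast
  from countable_open_cover[of "\<lambda>U. \<exists>\<phi> \<psi>. local_trivialization L U \<phi> \<psi>", OF this] obtain U
    where U: "\<And>n::nat. open (U n)" "\<And>n. \<exists>\<phi> \<psi>. local_trivialization L (U n) \<phi> \<psi>" "(\<Union>n. U n) = UNIV"
    by blast
  from U(2) obtain \<phi> \<psi> where T: "\<And>n. local_trivialization L (U n) (\<phi> n) (\<psi> n)" by metis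
  define i where "i = cover_index U"
  have iU: "x \<in> U (i x)" for x unfolding i_def by (rule cover_index[OF U(3)])
  note triv = trivialization[OF L T]
  define N where "N n x = fibre_norm L (\<psi> n (x, 1))" for n x
  have N: "N n x > 0" if "x \<in> U n" for n x
    unfolding N_def by (rule trivialization_norm_pos[OF L T that])
  \<comment> \<open>Multiplying the coordinate by the length of the frame vector amounts to dividing
    that vector by its length. The trivialization is the first of the cover whose domain contains
    the base point.\<close>
  define \<kappa> where "\<kappa> u = snd (\<phi> (i (bproj L u)) u) * of_real (N (i (bproj L u)) (bproj L u))" for u
  have \<kappa>: "\<kappa> u = snd (\<phi> (i x) u) * of_real (N (i x) x)" if "u \<in> fibre L x" for u x
    using that by (simp add: \<kappa>_def fibre_def)
  have \<kappa>\<psi>: "\<kappa> (\<psi> (i x) (x, c)) = c * of_real (N (i x) x)" for x c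
    using \<kappa>[OF triv(1)[OF iU]] triv(2)[OF iU, of x c] by simp
  have sc: "scalar_coordinate L \<kappa>"
  proof
    show "u \<in> fibre L x \<Longrightarrow> v \<in> fibre L x \<Longrightarrow> badd L u v \<in> fibre L x" for u v x by (rule herm_add[OF L])
    show "u \<in> fibre L x \<Longrightarrow> bscale L c u \<in> fibre L x" for u c x by (rule herm_scale[OF L])
    show "bij_betw \<kappa> (fibre L x) UNIV" for x
    proof (rule bij_betwI[where g = "\<lambda>c. \<psi> (i x) (x, c / of_real (N (i x) x))"])
      show "\<psi> (i x) (x, \<kappa> u / of_real (N (i x) x)) = u" if "u \<in> fibre L x" for u
        using N[OF iU, of x] triv(3)[OF iU that] by (simp add: \<kappa>[OF that])
      show "\<kappa> (\<psi> (i x) (x, c / of_real (N (i x) x))) = c" for c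
        using N[OF iU, of x] by (simp add: \<kappa>\<psi>)
    qed (use triv(1)[OF iU] in auto)
    show "\<kappa> (badd L u v) = \<kappa> u + \<kappa> v" if "u \<in> fibre L x" "v \<in> fibre L x" for u v x
      using triv(4)[OF iU that] by (simp add: \<kappa>[OF that(1)] \<kappa>[OF that(2)] \<kappa>[OF herm_add[OF L that]] algebra_simps)
    show "\<kappa> (bscale L c u) = c * \<kappa> u" if "u \<in> fibre L x" for u c x
      using triv(5)[OF iU that, of c] by (simp add: \<kappa>[OF that] \<kappa>[OF herm_scale[OF L that]])
    show "bherm L u v = \<kappa> u * cnj (\<kappa> v)" if "u \<in> fibre L x" "v \<in> fibre L x" for u v x
      unfolding trivialization_herm[OF L T iU that] \<kappa>[OF that(1)] \<kappa>[OF that(2)] N_def ..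
  qed
  interpret scalar_coordinate L \<kappa> by (rule sc)
  show thesis
  proof (rule that[OF sc])
    fix \<Omega> assume \<Omega>: "continuous_hom_section L \<Omega>"
    have hom: "\<Omega> x y \<in> fibre_hom L x y" for x y using \<Omega> by (simp add: continuous_hom_section_def)
    show "(\<lambda>(x, y). coeff x (\<Omega> x y)) \<in> borel_measurable borel"
    proof (rule borel_measurable_if_continuous_on_cover[OF U(1,3)])
      fix m n
      let ?S = "{a. cover_index U a = m} \<times> {b. cover_index U b = n}"
      have S: "i (fst z) = m" "i (snd z) = n" "fst z \<in> U m" "snd z \<in> U n" if "z \<in> ?S" for z
        using that iU[of "fst z"] iU[of "snd z"] by (auto simp: i_def)
      have sub: "?S \<subseteq> U m \<times> U n"
      proof
        fix z assume "z \<in> ?S" then show "z \<in> U m \<times> U n" using S(3,4)[of z] by (simp add: mem_Times_iff)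
      qed
      have cN: "continuous_on (U k) (N k)" for k
        unfolding N_def by (rule continuous_on_trivialization_norm[OF L T])
      have "continuous_on (U m \<times> U n) (\<lambda>(x, y). snd (\<phi> n (\<Omega> x y (\<psi> m (x, 1)))))"
        using \<Omega> T unfolding continuous_hom_section_def by blast
      then have c1: "continuous_on ?S (\<lambda>z. snd (\<phi> n (\<Omega> (fst z) (snd z) (\<psi> m (fst z, 1)))))"
        using continuous_on_subset[OF _ sub] by (simp add: case_prod_beta)
      have c2: "continuous_on ?S (\<lambda>z. N m (fst z))" "continuous_on ?S (\<lambda>z. N n (snd z))"
        by (rule continuous_on_compose2[OF cN]; use sub in \<open>auto intro!: continuous_intros\<close>)+
      \<comment> \<open>Change of frame: normalizing the source frame divides by its length,
        normalizing the target frame multiplies by its length. The right-hand side is continuous on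
        the block.\<close>
      have eq: "coeff (fst z) (\<Omega> (fst z) (snd z)) =
          snd (\<phi> n (\<Omega> (fst z) (snd z) (\<psi> m (fst z, 1)))) * of_real (N n (snd z)) / of_real (N m (fst z))"
        if "z \<in> ?S" for z
      proof -
        let ?x = "fst z" and ?y = "snd z"
        let ?u = "\<psi> m (?x, 1)"
        have u: "?u \<in> fibre L ?x" by (rule triv(1)[OF S(3)[OF that]])
        have "\<kappa> (\<Omega> ?x ?y ?u) = coeff ?x (\<Omega> ?x ?y) * of_real (N m ?x)"
          using coeff[OF hom u, of ?y] \<kappa>\<psi>[of ?x 1] S(1)[OF that] by simp
        moreover have "\<kappa> (\<Omega> ?x ?y ?u) = snd (\<phi> n (\<Omega> ?x ?y ?u)) * of_real (N n ?y)"
          using \<kappa>[OF hom_in_fibre[OF hom u]] S(2)[OF that] by simp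
        ultimately show ?thesis using N[OF S(3)[OF that]] by (simp add: field_simps)
      qed
      have "continuous_on ?S (\<lambda>z. snd (\<phi> n (\<Omega> (fst z) (snd z) (\<psi> m (fst z, 1)))) * of_real (N n (snd z)) / of_real (N m (fst z)))"
        using N S(3) by (intro continuous_intros c1 c2) (fastforce dest: N[OF S(3)])
      then have "continuous_on ?S (\<lambda>z. coeff (fst z) (\<Omega> (fst z) (snd z)))"
        by (rule continuous_on_eq) (simp add: eq)
      then show "continuous_on ?S (\<lambda>(x, y). coeff x (\<Omega> x y))" by (simp add: case_prod_beta)
    qed
  qed
qed

text \<open>The coefficient of \<open>\<Omega>\<close> may jump between pieces of the cover, where
  the unit frame changes its phase. Its modulus is the operator norm, which is independent of frames
  and can be computed in any trivialization near \<open>y\<close>.\<close>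

lemma continuous_on_hom_norm:
  fixes L :: "('m::topological_space, 'l::topological_space) line_bundle"
  assumes L: "hermitian_line_bundle L" and sc: "scalar_coordinate L \<kappa>" and \<Omega>: "continuous_hom_section L \<Omega>"
  shows "continuous_on UNIV (\<lambda>y. hom_norm L x (\<Omega> x y))"
proof -
  interpret scalar_coordinate L \<kappa> by (rule sc)
  have hom: "\<Omega> x y \<in> fibre_hom L x y" for x y using \<Omega> by (simp add: continuous_hom_section_def)
  obtain U \<phi> \<psi> where x: "x \<in> U" and T: "local_trivialization L U \<phi> \<psi>" using ex_trivialization[OF L] by blast
  let ?u = "\<psi> (x, 1)"
  have u: "?u \<in> fibre L x" by (rule trivialization(1)[OF L T x])
  have u0: "fibre_norm L ?u > 0" by (rule trivialization_norm_pos[OF L T x])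
  have loc: "\<exists>V. y \<in> V \<and> open V \<and> continuous_on V (\<lambda>y. hom_norm L x (\<Omega> x y))" for y
  proof -
    obtain V \<phi>' \<psi>' where y: "y \<in> V" and T': "local_trivialization L V \<phi>' \<psi>'" using ex_trivialization[OF L] by blast
    have "continuous_on (U \<times> V) (\<lambda>(x, y). snd (\<phi>' (\<Omega> x y (\<psi> (x, 1)))))"
      using \<Omega> T T' unfolding continuous_hom_section_def by blast
    then have "continuous_on V (\<lambda>y. case (x, y) of (x, y) \<Rightarrow> snd (\<phi>' (\<Omega> x y (\<psi> (x, 1)))))"
      by (rule continuous_on_compose2) (use x in \<open>auto intro!: continuous_intros\<close>)
    then have c: "continuous_on V (\<lambda>y. norm (snd (\<phi>' (\<Omega> x y ?u))) * fibre_norm L (\<psi>' (y, 1)) / fibre_norm L ?u)"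
      using u0 by (intro continuous_on_divide continuous_on_mult continuous_on_norm continuous_on_const
        continuous_on_trivialization_norm[OF L T']) auto
    have "hom_norm L x (\<Omega> x z) = norm (snd (\<phi>' (\<Omega> x z ?u))) * fibre_norm L (\<psi>' (z, 1)) / fibre_norm L ?u"
      if z: "z \<in> V" for z
    proof -
      have "fibre_norm L (\<Omega> x z ?u) = hom_norm L x (\<Omega> x z) * fibre_norm L ?u"
        unfolding fibre_norm[OF u] fibre_norm[OF hom_in_fibre[OF hom u]] hom_norm[OF hom] coeff[OF hom u]
        by (rule norm_mult)
      then show ?thesis
        using u0 trivialization_fibre_norm[OF L T' z hom_in_fibre[OF hom u]] by (simp add: field_simps)
    qed
    then have "continuous_on V (\<lambda>y. hom_norm L x (\<Omega> x y))" using c by (simp cong: continuous_on_cong_simp)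
    then show ?thesis using y trivialization(6)[OF L T'] by blast
  qed
  from loc obtain V where V: "\<And>y. y \<in> V y" "\<And>y. open (V y)" "\<And>y. continuous_on (V y) (\<lambda>y. hom_norm L x (\<Omega> x y))"
    by metis
  have "continuous_on (\<Union>y\<in>UNIV. V y) (\<lambda>y. hom_norm L x (\<Omega> x y))"
    by (intro continuous_on_open_UN V)
  moreover have "(\<Union>y\<in>UNIV. V y) = UNIV" using V(1) by blast
  ultimately show ?thesis by simp
qed

section \<open>From the propagator to a scalar kernel on a \<open>\<sigma>\<close>-finite measure
  space\<close>

locale scalar_propagator =
  fixes \<mu> :: "'m::second_countable_topology measure" and w :: "'m \<Rightarrow> 'm \<Rightarrow> complex" and C :: ennreal
  assumes sets_\<mu>: "sets \<mu> = sets borel"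
    and w_measurable: "(\<lambda>(x, y). w x y) \<in> borel_measurable borel"
    and sigma_finite: "sigma_finite_measure \<mu>"
    and w_le_1: "norm (w x y) \<le> 1"
    and w_integral: "(\<integral>\<^sup>+ y. ennreal (norm (w x y)) \<partial>\<mu>) \<le> C" and C_finite: "C < \<infinity>"
    and semigroup: "has_bochner_integral \<mu> (\<lambda>z. w x z * w z y) (w x y)"

lemma scalar_propagator_coeff:
  fixes L :: "('m::second_countable_topology, 'l::topological_space) line_bundle"
  assumes L: "hermitian_line_bundle L" and sc: "scalar_coordinate L \<kappa>" and \<Omega>: "propagator L \<mu> \<Omega>"
    and meas: "(\<lambda>(x, y). scalar_coordinate.coeff L \<kappa> x (\<Omega> x y)) \<in> borel_measurable borel"
    and \<mu>: "sets \<mu> = sets borel"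
  shows "\<exists>C. scalar_propagator \<mu> (\<lambda>x y. scalar_coordinate.coeff L \<kappa> x (\<Omega> x y)) C"
proof -
  interpret scalar_coordinate L \<kappa> by (rule sc)
  have cont: "continuous_hom_section L \<Omega>" and id: "\<And>x. \<Omega> x x = hom_id L x"
    and lt1: "\<And>x y. x \<noteq> y \<Longrightarrow> hom_norm L x (\<Omega> x y) < 1"
    and semi: "\<And>x y. has_hom_integral L x y \<mu> UNIV (\<lambda>z. hom_mult L x (\<Omega> x z) (\<Omega> z y)) (\<Omega> x y)"
    and fin: "(SUP x. \<integral>\<^sup>+ y. ennreal (hom_norm L x (\<Omega> x y)) \<partial>\<mu>) < \<infinity>"
    using \<Omega> unfolding propagator_def by simp_all
  have hom: "\<Omega> x y \<in> fibre_hom L x y" for x y using cont by (simp add: continuous_hom_section_def)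
  have norm: "hom_norm L x (\<Omega> x y) = norm (coeff x (\<Omega> x y))" for x y by (rule hom_norm[OF hom])
  have one: "coeff x (\<Omega> x x) = 1" for x by (simp add: id hom_id_def coeff_def vec)
  let ?C = "SUP x. \<integral>\<^sup>+ y. ennreal (norm (coeff x (\<Omega> x y))) \<partial>\<mu>"
  have C: "?C < \<infinity>" using fin by (simp add: norm)
  have le_C: "(\<integral>\<^sup>+ y. ennreal (norm (coeff x (\<Omega> x y))) \<partial>\<mu>) \<le> ?C" for x
    by (rule SUP_upper) simp
  have sp: "space \<mu> = UNIV" using sets_eq_imp_space_eq[OF \<mu>] by simp
  have fin_nbh: "\<exists>U. open U \<and> x \<in> U \<and> emeasure \<mu> U < \<infinity>" for x
  proof -
    \<comment> \<open>The threshold 1/2 is a choice below the value 1 at \<open>y = x\<close>: the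
      set is an open neighbourhood of \<open>x\<close>, and since
      \<open>1 \<le> 2 * |w(x, y)|\<close> on it, its measure is at most
      \<open>2 * ?C\<close>.\<close>
    let ?U = "{y. norm (coeff x (\<Omega> x y)) > 1/2}"
    have c: "continuous_on UNIV (\<lambda>y. norm (coeff x (\<Omega> x y)))"
      using continuous_on_hom_norm[OF L sc cont, of x] by (simp add: norm)
    have U: "open ?U" by (intro open_Collect_less c continuous_intros)
    then have Us: "?U \<in> sets \<mu>" by (simp add: \<mu>)
    have "emeasure \<mu> ?U = (\<integral>\<^sup>+ y. indicator ?U y \<partial>\<mu>)" using Us by simp
    also have "\<dots> \<le> (\<integral>\<^sup>+ y. 2 * ennreal (norm (coeff x (\<Omega> x y))) \<partial>\<mu>)"
    proof (rule nn_integral_mono)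
      fix y
      have "1 \<le> 2 * ennreal r" if "r > 1/2" for r
        using that ennreal_leI[of 1 "2 * r"] by (simp add: ennreal_mult)
      then show "indicator ?U y \<le> 2 * ennreal (norm (coeff x (\<Omega> x y)))" by (simp add: indicator_def)
    qed
    also have "\<dots> = 2 * (\<integral>\<^sup>+ y. ennreal (norm (coeff x (\<Omega> x y))) \<partial>\<mu>)"
    proof (rule nn_integral_cmult)
      have "(\<lambda>y. norm (coeff x (\<Omega> x y))) \<in> borel_measurable borel"
        using c by (rule borel_measurable_continuous_onI)
      then show "(\<lambda>y. ennreal (norm (coeff x (\<Omega> x y)))) \<in> borel_measurable \<mu>"
        by (simp cong: measurable_cong_sets add: measurable_cong_sets[OF \<mu> refl])
    qed
    also have "\<dots> \<le> 2 * ?C" by (intro mult_left_mono le_C) simp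
    also have "\<dots> < \<infinity>" using C by (simp add: ennreal_mult_less_top)
    finally show ?thesis using U one by (intro exI[of _ ?U]) simp
  qed
  obtain V where V: "\<And>n::nat. open (V n)" "\<And>n. emeasure \<mu> (V n) < \<infinity>" "(\<Union>n. V n) = UNIV"
    using countable_open_cover[of "\<lambda>U. emeasure \<mu> U < \<infinity>", OF fin_nbh] by blast
  have "scalar_propagator \<mu> (\<lambda>x y. coeff x (\<Omega> x y)) ?C"
  proof
    show "\<exists>A. countable A \<and> A \<subseteq> sets \<mu> \<and> \<Union>A = space \<mu> \<and> (\<forall>a\<in>A. emeasure \<mu> a \<noteq> \<infinity>)"
    proof (intro exI[of _ "range V"] conjI ballI)
      show "range V \<subseteq> sets \<mu>" using V(1) by (auto simp: \<mu>)
      show "emeasure \<mu> a \<noteq> \<infinity>" if "a \<in> range V" for a using that V(2) by (auto simp: less_top)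
    qed (use V(3) sp in auto)
    show "norm (coeff x (\<Omega> x y)) \<le> 1" for x y
      using lt1[of x y] one[of x] by (cases "x = y") (simp_all add: norm)
    show "has_bochner_integral \<mu> (\<lambda>z. coeff x (\<Omega> x z) * coeff z (\<Omega> z y)) (coeff x (\<Omega> x y))" for x y
      using semi[of x y] unfolding has_hom_integral_iff by (simp add: hom_mult(2)[OF hom hom])
  qed (fact \<mu> meas le_C C)+
  then show ?thesis ..
qed

section \<open>Integrals of products of a scalar kernel\<close>

fun scalar_chain :: "('m \<Rightarrow> 'm \<Rightarrow> complex) \<Rightarrow> 'm \<Rightarrow> 'm list \<Rightarrow> 'm \<Rightarrow> complex" where
  "scalar_chain w x [] y = w x y"
| "scalar_chain w x (z # zs) y = w x z * scalar_chain w z zs y"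

text \<open>Locates a new time in the sorted list of times, so that its variable occurs in exactly
  two neighbouring factors of the chain.\<close>

lemma insort_eq_append: "\<exists>as bs. xs = as @ bs \<and> insort t xs = as @ t # bs"
proof (induction xs)
  case (Cons a xs)
  then obtain as bs where "xs = as @ bs" "insort t xs = as @ t # bs" by blast
  then have "t \<le> a \<or> a # xs = (a # as) @ bs \<and> insort t (a # xs) = (a # as) @ t # bs" by simp
  then show ?case
  proof
    assume "t \<le> a"
    then show ?thesis by (intro exI[of _ "[]"] exI[of _ "a # xs"]) simp
  qed blast
qed simp

text \<open>Relabelling pulls boxes back to boxes of the same measure, and values on boxes determine
  a finite product of \<open>\<sigma>\<close>-finite measures. Used with \<open>f\<close> sending
  ranks to times.\<close>

lemma distr_PiM_reindex_finite:
  fixes f :: "'i \<Rightarrow> 'j"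
  assumes "sigma_finite_measure \<mu>" "finite J" "bij_betw f I J"
  shows "distr (Pi\<^sub>M J (\<lambda>_. \<mu>)) (Pi\<^sub>M I (\<lambda>_. \<mu>)) (\<lambda>\<eta>. \<lambda>i\<in>I. \<eta> (f i)) = Pi\<^sub>M I (\<lambda>_. \<mu>)"
proof -
  interpret J: product_sigma_finite "\<lambda>_::'j. \<mu>" by (rule product_sigma_finite.intro) (rule assms(1))
  interpret I: product_sigma_finite "\<lambda>_::'i. \<mu>" by (rule product_sigma_finite.intro) (rule assms(1))
  have finI: "finite I" using assms(2,3) bij_betw_finite by blast
  have fJ: "f i \<in> J" if "i \<in> I" for i using assms(3) that by (auto simp: bij_betw_def)
  have meas: "(\<lambda>\<eta>. \<lambda>i\<in>I. \<eta> (f i)) \<in> measurable (Pi\<^sub>M J (\<lambda>_. \<mu>)) (Pi\<^sub>M I (\<lambda>_. \<mu>))"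
    by (intro measurable_restrict measurable_component_singleton fJ)
  show ?thesis
  proof (rule I.PiM_eqI[OF finI])
    fix A assume A: "\<And>i. i \<in> I \<Longrightarrow> A i \<in> sets \<mu>"
    let ?g = "the_inv_into I f"
    have g: "?g t \<in> I" "f (?g t) = t" if "t \<in> J" for t
      using assms(3) that by (auto simp: bij_betw_def the_inv_into_into f_the_inv_into_f)
    have gf: "?g (f i) = i" if "i \<in> I" for i
      using assms(3) that by (auto simp: bij_betw_def the_inv_into_f_f)
    have "(\<lambda>\<eta>. \<lambda>i\<in>I. \<eta> (f i)) -` Pi\<^sub>E I A \<inter> space (Pi\<^sub>M J (\<lambda>_. \<mu>)) = Pi\<^sub>E J (\<lambda>t. A (?g t))"
    proof (intro subset_antisym subsetI)
      fix \<eta> assume *: "\<eta> \<in> (\<lambda>\<eta>. \<lambda>i\<in>I. \<eta> (f i)) -` Pi\<^sub>E I A \<inter> space (Pi\<^sub>M J (\<lambda>_. \<mu>))"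
      have "\<eta> t \<in> A (?g t)" if "t \<in> J" for t using * g[OF that] by (auto simp: PiE_iff)
      then show "\<eta> \<in> Pi\<^sub>E J (\<lambda>t. A (?g t))" using * by (auto simp: space_PiM PiE_iff)
    next
      fix \<eta> assume *: "\<eta> \<in> Pi\<^sub>E J (\<lambda>t. A (?g t))"
      have "\<eta> (f i) \<in> A i" if "i \<in> I" for i using * fJ[OF that] gf[OF that] by (metis PiE_mem)
      moreover have "\<eta> t \<in> space \<mu>" if "t \<in> J" for t
        using * that A[OF g(1)[OF that]] sets.sets_into_space by (auto simp: PiE_iff)
      ultimately show "\<eta> \<in> (\<lambda>\<eta>. \<lambda>i\<in>I. \<eta> (f i)) -` Pi\<^sub>E I A \<inter> space (Pi\<^sub>M J (\<lambda>_. \<mu>))"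
        using * by (auto simp: space_PiM PiE_iff)
    qed
    then have "emeasure (distr (Pi\<^sub>M J (\<lambda>_. \<mu>)) (Pi\<^sub>M I (\<lambda>_. \<mu>)) (\<lambda>\<eta>. \<lambda>i\<in>I. \<eta> (f i))) (Pi\<^sub>E I A) =
        emeasure (Pi\<^sub>M J (\<lambda>_. \<mu>)) (Pi\<^sub>E J (\<lambda>t. A (?g t)))"
      using A finI by (subst emeasure_distr[OF meas]) (auto intro: sets_PiM_I_finite)
    also have "\<dots> = (\<Prod>t\<in>J. emeasure \<mu> (A (?g t)))"
      by (rule J.emeasure_PiM[OF assms(2)]) (use A g in auto)
    also have "\<dots> = (\<Prod>i\<in>I. emeasure \<mu> (A i))"
      using prod.reindex_bij_betw[OF assms(3), of "\<lambda>t. emeasure \<mu> (A (?g t))"] gf by simp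
    finally show "emeasure (distr (Pi\<^sub>M J (\<lambda>_. \<mu>)) (Pi\<^sub>M I (\<lambda>_. \<mu>)) (\<lambda>\<eta>. \<lambda>i\<in>I. \<eta> (f i))) (Pi\<^sub>E I A) =
        (\<Prod>i\<in>I. emeasure \<mu> (A i))" .
  qed simp
qed

context scalar_propagator
begin

lemma space_\<mu>: "space \<mu> = UNIV"
  using sets_eq_imp_space_eq[OF sets_\<mu>] by simp

lemma sets_PiM_\<mu>: "sets (Pi\<^sub>M J (\<lambda>_. \<mu>)) = sets (Pi\<^sub>M J (\<lambda>_. borel))"
  by (intro sets_PiM_cong refl sets_\<mu>)

lemma w_measurable_compose:
  assumes "f \<in> borel_measurable N" "g \<in> borel_measurable N"
  shows "(\<lambda>z. w (f z) (g z)) \<in> borel_measurable N"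
  using measurable_compose[OF borel_measurable_Pair[OF assms] w_measurable] by simp

lemma scalar_chain_measurable:
  assumes "\<And>t. t \<in> set ts \<Longrightarrow> (\<lambda>z. \<eta> z t) \<in> borel_measurable N"
  shows "f \<in> borel_measurable N \<Longrightarrow> (\<lambda>z. scalar_chain w (f z) (map (\<eta> z) ts) y) \<in> borel_measurable N"
  using assms
proof (induction ts arbitrary: f)
  case Nil
  then show ?case
    by (simp add: w_measurable_compose)
next
  case (Cons t ts)
  have "(\<lambda>z. w (f z) (\<eta> z t)) \<in> borel_measurable N"
    using Cons.prems by (intro w_measurable_compose) auto
  moreover have "(\<lambda>z. scalar_chain w (\<eta> z t) (map (\<eta> z) ts) y) \<in> borel_measurable N"
    by (rule Cons.IH) (use Cons.prems in auto)
  ultimately show ?case by simp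
qed

lemma scalar_chain_measurable_PiM:
  assumes "set ts \<subseteq> J"
  shows "(\<lambda>\<eta>. scalar_chain w x (map \<eta> ts) y) \<in> borel_measurable (Pi\<^sub>M J (\<lambda>_. \<mu>))"
proof (rule scalar_chain_measurable)
  fix t assume "t \<in> set ts"
  then have "(\<lambda>\<eta>. \<eta> t) \<in> measurable (Pi\<^sub>M J (\<lambda>_. \<mu>)) \<mu>"
    using assms by (intro measurable_component_singleton) auto
  then show "(\<lambda>\<eta>. \<eta> t) \<in> borel_measurable (Pi\<^sub>M J (\<lambda>_. \<mu>))"
    using measurable_cong_sets[OF refl sets_\<mu>] by blast
qed simp

text \<open>The first variable is made the outermost one. The bound for the inner integral is
  uniform in the start \<open>z\<close> of the remaining chain, and the factor \<open>w x z\<close>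
  then contributes one more \<open>C\<close>. There is one factor more than variables; the last is
  absorbed by \<open>w_le_1\<close>.\<close>

lemma nn_integral_scalar_chain_le:
  fixes ts :: "'i list"
  shows "distinct ts \<Longrightarrow>
    (\<integral>\<^sup>+ \<eta>. ennreal (norm (scalar_chain w x (map \<eta> ts) y)) \<partial>Pi\<^sub>M (set ts) (\<lambda>_. \<mu>)) \<le> C ^ length ts"
proof (induction ts arbitrary: x)
  case Nil
  interpret product_sigma_finite "\<lambda>_. \<mu>" by (rule product_sigma_finite.intro) (rule sigma_finite)
  show ?case unfolding list.set(1) using w_le_1[of x y] by (subst nn_integral_empty) simp_all
next
  case (Cons t ts)
  interpret product_sigma_finite "\<lambda>_. \<mu>" by (rule product_sigma_finite.intro) (rule sigma_finite)
  have chain_meas: "(\<lambda>\<eta>. ennreal (norm (scalar_chain w x (map \<eta> us) y))) \<in> borel_measurable (Pi\<^sub>M J (\<lambda>_. \<mu>))"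
    if "set us \<subseteq> J" for us J x
  proof -
    note [measurable] = scalar_chain_measurable_PiM[OF that, of x y]
    show ?thesis by measurable
  qed
  have wm: "(\<lambda>z. ennreal (norm (w x z))) \<in> borel_measurable \<mu>"
  proof -
    have [measurable]: "(\<lambda>z. w x z) \<in> borel_measurable borel"
      by (intro w_measurable_compose measurable_const measurable_ident_sets) simp_all
    have "(\<lambda>z. ennreal (norm (w x z))) \<in> borel_measurable borel" by measurable
    then show ?thesis using measurable_cong_sets[OF sets_\<mu> refl] by blast
  qed
  have "(\<integral>\<^sup>+ \<eta>. ennreal (norm (scalar_chain w x (map \<eta> (t # ts)) y)) \<partial>Pi\<^sub>M (set (t # ts)) (\<lambda>_. \<mu>)) =
    (\<integral>\<^sup>+ z. \<integral>\<^sup>+ \<eta>. ennreal (norm (scalar_chain w x (map (\<eta>(t := z)) (t # ts)) y)) \<partial>Pi\<^sub>M (set ts) (\<lambda>_. \<mu>) \<partial>\<mu>)"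
    unfolding list.set(2)
  proof (rule product_nn_integral_insert_rev)
    show "t \<notin> set ts" using Cons.prems by simp
    show "(\<lambda>\<eta>. ennreal (norm (scalar_chain w x (map \<eta> (t # ts)) y))) \<in> borel_measurable (Pi\<^sub>M (insert t (set ts)) (\<lambda>_. \<mu>))"
      by (rule chain_meas) simp
  qed simp
  also have "\<dots> = (\<integral>\<^sup>+ z. ennreal (norm (w x z)) *
      (\<integral>\<^sup>+ \<eta>. ennreal (norm (scalar_chain w z (map \<eta> ts) y)) \<partial>Pi\<^sub>M (set ts) (\<lambda>_. \<mu>)) \<partial>\<mu>)"
  proof (rule nn_integral_cong)
    fix z
    have "scalar_chain w x (map (\<eta>(t := z)) (t # ts)) y = w x z * scalar_chain w z (map \<eta> ts) y"
      for \<eta> :: "'i \<Rightarrow> 'm"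
    proof -
      have "map (\<eta>(t := z)) ts = map \<eta> ts" using Cons.prems by (intro map_cong) auto
      then show ?thesis by (simp only: list.map(2) scalar_chain.simps(2) fun_upd_same)
    qed
    then have "(\<integral>\<^sup>+ \<eta>. ennreal (norm (scalar_chain w x (map (\<eta>(t := z)) (t # ts)) y)) \<partial>Pi\<^sub>M (set ts) (\<lambda>_. \<mu>)) =
      (\<integral>\<^sup>+ \<eta>. ennreal (norm (w x z)) * ennreal (norm (scalar_chain w z (map \<eta> ts) y)) \<partial>Pi\<^sub>M (set ts) (\<lambda>_. \<mu>))"
      by (simp only: norm_mult ennreal_mult norm_ge_zero)
    also have "\<dots> = ennreal (norm (w x z)) * (\<integral>\<^sup>+ \<eta>. ennreal (norm (scalar_chain w z (map \<eta> ts) y)) \<partial>Pi\<^sub>M (set ts) (\<lambda>_. \<mu>))"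
      by (intro nn_integral_cmult chain_meas) simp
    finally show "(\<integral>\<^sup>+ \<eta>. ennreal (norm (scalar_chain w x (map (\<eta>(t := z)) (t # ts)) y)) \<partial>Pi\<^sub>M (set ts) (\<lambda>_. \<mu>)) =
      ennreal (norm (w x z)) * (\<integral>\<^sup>+ \<eta>. ennreal (norm (scalar_chain w z (map \<eta> ts) y)) \<partial>Pi\<^sub>M (set ts) (\<lambda>_. \<mu>))" .
  qed
  also have "\<dots> \<le> (\<integral>\<^sup>+ z. ennreal (norm (w x z)) * C ^ length ts \<partial>\<mu>)"
    using Cons.prems by (intro nn_integral_mono mult_left_mono Cons.IH) auto
  also have "\<dots> = (\<integral>\<^sup>+ z. ennreal (norm (w x z)) \<partial>\<mu>) * C ^ length ts"
    by (rule nn_integral_multc[OF wm])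
  also have "\<dots> \<le> C * C ^ length ts" by (intro mult_right_mono w_integral) simp
  finally show ?case by simp
qed

lemma integrable_scalar_chain:
  assumes "finite J"
  shows "integrable (Pi\<^sub>M J (\<lambda>_. \<mu>)) (\<lambda>\<eta>. scalar_chain w x (map \<eta> (sorted_list_of_set J)) y)"
proof (rule integrableI_bounded)
  show "(\<lambda>\<eta>. scalar_chain w x (map \<eta> (sorted_list_of_set J)) y) \<in> borel_measurable (Pi\<^sub>M J (\<lambda>_. \<mu>))"
    using assms by (intro scalar_chain_measurable_PiM) simp
  have "(\<integral>\<^sup>+ \<eta>. ennreal (norm (scalar_chain w x (map \<eta> (sorted_list_of_set J)) y)) \<partial>Pi\<^sub>M J (\<lambda>_. \<mu>)) \<le>
      C ^ length (sorted_list_of_set J)"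
    using nn_integral_scalar_chain_le[of "sorted_list_of_set J" x y] assms by simp
  also have "\<dots> < \<infinity>" using C_finite by (simp add: power_less_top_ennreal)
  finally show "(\<integral>\<^sup>+ \<eta>. ennreal (norm (scalar_chain w x (map \<eta> (sorted_list_of_set J)) y)) \<partial>Pi\<^sub>M J (\<lambda>_. \<mu>)) < \<infinity>" .
qed

text \<open>Only the two factors next to \<open>z\<close> depend on it; (4) merges them, and the
  others are constants. For \<open>bs = []\<close> the right neighbour of \<open>z\<close> is the
  endpoint \<open>y\<close>.\<close>

lemma scalar_chain_insert:
  "has_bochner_integral \<mu> (\<lambda>z. scalar_chain w x (as @ z # bs) y) (scalar_chain w x (as @ bs) y)"
proof (induction as arbitrary: x)
  case Nil
  show ?case
  proof (cases bs)
    case Nil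
    then show ?thesis using semigroup by simp
  next
    case (Cons v vs)
    then show ?thesis
      using has_bochner_integral_mult_left[OF semigroup[of x v], of "scalar_chain w v vs y"] by (simp add: mult.assoc)
  qed
next
  case (Cons a as)
  then show ?case by (simp add: has_bochner_integral_mult_right)
qed

definition cylinder_integral :: "'m \<Rightarrow> 'm \<Rightarrow> real set \<Rightarrow> (real \<Rightarrow> 'm) set \<Rightarrow> complex" where
  "cylinder_integral x y J B =
     (LINT \<eta>|Pi\<^sub>M J (\<lambda>_. \<mu>). indicator B \<eta> *\<^sub>R scalar_chain w x (map \<eta> (sorted_list_of_set J)) y)"

lemma integrable_cylinder:
  assumes "finite J" "B \<in> sets (Pi\<^sub>M J (\<lambda>_. \<mu>))"
  shows "integrable (Pi\<^sub>M J (\<lambda>_. \<mu>)) (\<lambda>\<eta>. indicator B \<eta> *\<^sub>R scalar_chain w x (map \<eta> (sorted_list_of_set J)) y)"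
  using assms by (intro integrable_mult_indicator integrable_scalar_chain)

text \<open>The semigroup property (4) integrates out the variable at the additional time \<open>t\<close>.\<close>

lemma cylinder_integral_insert:
  assumes J: "finite J" "t \<notin> J" and B: "B \<in> sets (Pi\<^sub>M (insert t J) (\<lambda>_. \<mu>))"
    and B': "\<And>\<eta>. \<eta> \<in> extensional (insert t J) \<Longrightarrow> \<eta> \<in> B \<longleftrightarrow> restrict \<eta> J \<in> B'"
  shows "cylinder_integral x y (insert t J) B = cylinder_integral x y J B'"
proof -
  interpret product_sigma_finite "\<lambda>_. \<mu>" by (rule product_sigma_finite.intro) (rule sigma_finite)
  obtain as bs where ab: "sorted_list_of_set J = as @ bs" "sorted_list_of_set (insert t J) = as @ t # bs"
    using insort_eq_append[of "sorted_list_of_set J" t] J by auto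
  have "set (as @ bs) = J" unfolding ab(1)[symmetric] using J(1) by simp
  then have t: "t \<notin> set as" "t \<notin> set bs" using J(2) by auto
  have "cylinder_integral x y (insert t J) B =
    (LINT \<eta>|Pi\<^sub>M J (\<lambda>_. \<mu>). LINT z|\<mu>. indicator B (\<eta>(t := z)) *\<^sub>R scalar_chain w x (map (\<eta>(t := z)) (as @ t # bs)) y)"
    unfolding cylinder_integral_def ab(2)
    by (rule product_integral_insert[OF J]) (use integrable_cylinder[OF _ B, of x y] J(1) ab(2) in simp)
  also have "\<dots> = (LINT \<eta>|Pi\<^sub>M J (\<lambda>_. \<mu>). indicator B' \<eta> *\<^sub>R scalar_chain w x (map \<eta> (as @ bs)) y)"
  proof (rule Bochner_Integration.integral_cong[OF refl])
    fix \<eta> assume \<eta>: "\<eta> \<in> space (Pi\<^sub>M J (\<lambda>_. \<mu>))"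
    then have "\<eta>(t := z) \<in> extensional (insert t J)" "restrict (\<eta>(t := z)) J = \<eta>" for z
      using J(2) by (auto simp: space_PiM PiE_def extensional_def restrict_def)
    \<comment> \<open>The set does not see the new coordinate, so its indicator leaves the inner
      integral, which then runs over the whole of \<open>M\<close> as (4) requires.\<close>
    then have "indicat_real B (\<eta>(t := z)) = indicator B' \<eta>" for z using B'[of "\<eta>(t := z)"] by (simp add: indicator_def)
    moreover have upd: "map (\<eta>(t := z)) (as @ t # bs) = map \<eta> as @ z # map \<eta> bs" for z using t by simp
    moreover have "(LINT z|\<mu>. scalar_chain w x (map \<eta> as @ z # map \<eta> bs) y) = scalar_chain w x (map \<eta> as @ map \<eta> bs) y"
      by (rule has_bochner_integral_integral_eq[OF scalar_chain_insert])
    ultimately show "(LINT z|\<mu>. indicator B (\<eta>(t := z)) *\<^sub>R scalar_chain w x (map (\<eta>(t := z)) (as @ t # bs)) y) =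
        indicator B' \<eta> *\<^sub>R scalar_chain w x (map \<eta> (as @ bs)) y"
      by (simp only: integral_scaleR_right map_append[of \<eta> as bs])
  qed
  also have "\<dots> = cylinder_integral x y J B'" unfolding cylinder_integral_def ab(1) ..
  finally show ?thesis .
qed

text \<open>Dominated convergence for the indicators of the partial unions, with the integrable
  modulus of the chain as the dominating function.\<close>

lemma cylinder_integral_sums:
  assumes J: "finite J" and B: "\<And>i::nat. B i \<in> sets (Pi\<^sub>M J (\<lambda>_. \<mu>))" and disj: "disjoint_family B"
  shows "(\<lambda>i. cylinder_integral x y J (B i)) sums cylinder_integral x y J (\<Union>i. B i)"
proof -
  let ?M = "Pi\<^sub>M J (\<lambda>_. \<mu>)" and ?f = "\<lambda>\<eta>. scalar_chain w x (map \<eta> (sorted_list_of_set J)) y"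
  have "(\<lambda>n. LINT \<eta>|?M. indicator (\<Union>i<n. B i) \<eta> *\<^sub>R ?f \<eta>) \<longlonglongrightarrow> (LINT \<eta>|?M. indicator (\<Union>i. B i) \<eta> *\<^sub>R ?f \<eta>)"
  proof (rule integral_dominated_convergence[where w = "\<lambda>\<eta>. norm (?f \<eta>)"])
    show "integrable ?M (\<lambda>\<eta>. norm (?f \<eta>))" by (intro integrable_norm integrable_scalar_chain J)
    show "AE \<eta> in ?M. (\<lambda>n. indicator (\<Union>i<n. B i) \<eta> *\<^sub>R ?f \<eta>) \<longlonglongrightarrow> indicator (\<Union>i. B i) \<eta> *\<^sub>R ?f \<eta>"
      by (intro AE_I2 tendsto_scaleR LIMSEQ_indicator_UN tendsto_const)
    show "(\<lambda>\<eta>. indicator (\<Union>i. B i) \<eta> *\<^sub>R ?f \<eta>) \<in> borel_measurable ?M"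
      "(\<lambda>\<eta>. indicator (\<Union>i<n. B i) \<eta> *\<^sub>R ?f \<eta>) \<in> borel_measurable ?M" for n
      using B by (auto intro!: borel_measurable_integrable integrable_cylinder J)
    show "AE \<eta> in ?M. norm (indicator (\<Union>i<n. B i) \<eta> *\<^sub>R ?f \<eta>) \<le> norm (?f \<eta>)" for n
      by (intro AE_I2) (simp add: indicator_def)
  qed
  moreover have "(LINT \<eta>|?M. indicator (\<Union>i<n. B i) \<eta> *\<^sub>R ?f \<eta>) = (\<Sum>i<n. cylinder_integral x y J (B i))" for n
  proof -
    have "indicat_real (\<Union>i<n. B i) \<eta> = (\<Sum>i<n. indicator (B i) \<eta>)" for \<eta>
      by (rule indicator_UN_disjoint) (use disj in \<open>auto simp: disjoint_family_on_def\<close>)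
    then have "(LINT \<eta>|?M. indicator (\<Union>i<n. B i) \<eta> *\<^sub>R ?f \<eta>) = (LINT \<eta>|?M. (\<Sum>i<n. indicator (B i) \<eta> *\<^sub>R ?f \<eta>))"
      by (simp add: scaleR_sum_left)
    also have "\<dots> = (\<Sum>i<n. cylinder_integral x y J (B i))"
      unfolding cylinder_integral_def by (intro Bochner_Integration.integral_sum integrable_cylinder J B)
    finally show ?thesis .
  qed
  ultimately show ?thesis by (simp add: sums_def cylinder_integral_def)
qed

end

section \<open>The inverse system and its limit\<close>

lemma sorted_list_of_partition:
  assumes D: "D \<in> time_partitions"
  shows "sorted_list_of_set D = 0 # sorted_list_of_set (D - {0, 1}) @ [1]"
proof -
  have fin: "finite D" and sub: "D \<subseteq> {0..1}" and in01: "0 \<in> D" "1 \<in> D" using D by (auto simp: time_partitions_def)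
  have *: "0 < t \<and> t < 1" if "t \<in> D - {0, 1}" for t using that sub by force
  let ?l = "sorted_list_of_set (D - {0, 1})"
  have "sorted (0 # ?l @ [1])" using * fin by (auto simp: sorted_append less_imp_le)
  moreover have "distinct (0 # ?l @ [1])" using fin by auto
  moreover have "set (0 # ?l @ [1]) = D" using fin in01 by auto
  ultimately show ?thesis using fin by (metis sorted_list_of_set.idem_if_sorted_distinct)
qed

text \<open>Rank 0 is the time 0 and the last rank \<open>card D - 1\<close> is the time 1, so the
  ranks strictly between list the interior times in increasing order.\<close>

lemma map_part_time:
  assumes D: "D \<in> time_partitions"
  shows "map (part_time D) [1..<card D - 1] = sorted_list_of_set (D - {0, 1})"
proof (rule nth_equalityI)
  let ?l = "sorted_list_of_set (D - {0, 1})"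
  have "length (sorted_list_of_set D) = length ?l + 2" by (simp add: sorted_list_of_partition[OF D])
  then have len: "card D - 1 = length ?l + 1" by simp
  then show "length (map (part_time D) [1..<card D - 1]) = length ?l" by simp
  fix i assume "i < length (map (part_time D) [1..<card D - 1])"
  then have i: "i < length ?l" using len by simp
  then have "map (part_time D) [1..<card D - 1] ! i = sorted_list_of_set D ! Suc i"
    unfolding len by (simp add: part_time_def del: upt_Suc)
  also have "\<dots> = ?l ! i"
    unfolding sorted_list_of_partition[OF D] nth_Cons_Suc nth_append using i by (rule if_P)
  finally show "map (part_time D) [1..<card D - 1] ! i = ?l ! i" .
qed

lemma bij_betw_part_time:
  assumes D: "D \<in> time_partitions"
  shows "bij_betw (part_time D) (inner_index D) (D - {0, 1})"
proof -
  have fin: "finite D" using D by (simp add: time_partitions_def)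
  have "distinct (map (part_time D) [1..<card D - 1])" unfolding map_part_time[OF D] by simp
  moreover have "set (map (part_time D) [1..<card D - 1]) = D - {0, 1}"
    unfolding map_part_time[OF D] using fin by simp
  ultimately show ?thesis unfolding bij_betw_def inner_index_def by (simp add: distinct_map)
qed

context scalar_propagator
begin

text \<open>The bridge from the rank-indexed product of the statement to the time-indexed one. The
  relabelling \<open>R\<close> has the measurable inverse \<open>R'\<close>, so it carries the
  measurable base to a measurable set; the integral is transported by change of variables.\<close>

lemma part_eval_image_integral:
  fixes x y :: 'm
  assumes D: "D \<in> time_partitions" and B: "cyl_base D A \<in> sets (Pi\<^sub>M (D - {0, 1}) (\<lambda>_. borel))"
  defines "f \<equiv> \<lambda>\<xi>. indicator (part_eval D ` A) \<xi> *\<^sub>R scalar_chain w x (map \<xi> [1..<card D - 1]) y"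
  shows "part_eval D ` A \<in> sets (part_product \<mu> D)" "integrable (part_product \<mu> D) f"
    "integral\<^sup>L (part_product \<mu> D) f = cylinder_integral x y (D - {0, 1}) (cyl_base D A)"
proof -
  define I J where "I = inner_index D" and "J = D - {0, 1}"
  have finJ: "finite J" using D by (simp add: time_partitions_def J_def)
  have bij: "bij_betw (part_time D) I J" unfolding I_def J_def by (rule bij_betw_part_time[OF D])
  define s where "s = the_inv_into I (part_time D)"
  have s: "s t \<in> I" "part_time D (s t) = t" if "t \<in> J" for t
    using bij that by (auto simp: s_def bij_betw_def the_inv_into_into f_the_inv_into_f)
  have ps: "part_time D i \<in> J" "s (part_time D i) = i" if "i \<in> I" for i
    using bij that by (auto simp: s_def bij_betw_def the_inv_into_f_f)
  define R where "R \<eta> = (\<lambda>i\<in>I. \<eta> (part_time D i))" for \<eta> :: "real \<Rightarrow> 'm"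
  define R' where "R' \<xi> = (\<lambda>t\<in>J. \<xi> (s t))" for \<xi> :: "nat \<Rightarrow> 'm"
  have R'R: "R' (R \<eta>) = \<eta>" if "\<eta> \<in> extensional J" for \<eta>
    by (rule extensionalityI[OF _ that]) (simp_all add: R'_def R_def s)
  have RR': "R (R' \<xi>) = \<xi>" if "\<xi> \<in> extensional I" for \<xi>
    by (rule extensionalityI[OF _ that]) (simp_all add: R'_def R_def ps)
  let ?PI = "Pi\<^sub>M I (\<lambda>_. \<mu>)" and ?PJ = "Pi\<^sub>M J (\<lambda>_. \<mu>)"
  let ?B = "cyl_base D A"
  have Bs: "?B \<in> sets ?PJ" using B by (simp add: sets_PiM_\<mu> J_def)
  have Bext: "?B \<subseteq> extensional J" by (auto simp: cyl_base_def J_def)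
  have "part_eval D \<gamma> = R (restrict \<gamma> J)" for \<gamma>
    by (rule extensionalityI[of _ I]) (simp_all add: part_eval_def R_def I_def[symmetric] ps)
  then have img: "part_eval D ` A = R ` ?B" by (simp add: cyl_base_def image_image J_def)
  have prod: "part_product \<mu> D = ?PI" by (simp add: part_product_def I_def)
  have R'_meas: "R' \<in> measurable ?PI ?PJ"
    unfolding R'_def by (intro measurable_restrict measurable_component_singleton s)
  have R_meas: "R \<in> measurable ?PJ ?PI"
    unfolding R_def by (intro measurable_restrict measurable_component_singleton ps)
  have "R ` ?B = R' -` ?B \<inter> space ?PI"
  proof (intro subset_antisym subsetI)
    fix \<xi> assume "\<xi> \<in> R ` ?B"
    then obtain \<eta> where \<eta>: "\<eta> \<in> ?B" "\<xi> = R \<eta>" by (rule imageE)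
    moreover have "\<xi> \<in> space ?PI" using \<eta>(2) by (simp add: R_def space_PiM space_\<mu> PiE_def)
    moreover have "R' \<xi> = \<eta>" unfolding \<eta>(2) using R'R \<eta>(1) Bext by blast
    ultimately show "\<xi> \<in> R' -` ?B \<inter> space ?PI" by simp
  next
    fix \<xi> assume *: "\<xi> \<in> R' -` ?B \<inter> space ?PI"
    then have "\<xi> = R (R' \<xi>)" using RR' by (simp add: space_PiM PiE_def)
    with * show "\<xi> \<in> R ` ?B" by (intro image_eqI[of _ _ "R' \<xi>"]) simp_all
  qed
  then have RB: "R ` ?B \<in> sets ?PI" using measurable_sets[OF R'_meas Bs] by simp
  then show "part_eval D ` A \<in> sets (part_product \<mu> D)" by (simp add: img prod)
  have chain_meas: "(\<lambda>\<xi>. scalar_chain w x (map \<xi> [1..<card D - 1]) y) \<in> borel_measurable ?PI"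
    by (rule scalar_chain_measurable_PiM) (simp add: I_def inner_index_def)
  have f_meas: "f \<in> borel_measurable ?PI"
    unfolding f_def img using RB chain_meas by (intro borel_measurable_scaleR borel_measurable_indicator)
  have fR: "f (R \<eta>) = indicator ?B \<eta> *\<^sub>R scalar_chain w x (map \<eta> (sorted_list_of_set J)) y"
    if "\<eta> \<in> space ?PJ" for \<eta>
  proof -
    have \<eta>: "\<eta> \<in> extensional J" using that by (simp add: space_PiM PiE_def)
    have "R \<eta> \<in> R ` ?B \<longleftrightarrow> \<eta> \<in> ?B"
    proof
      assume "R \<eta> \<in> R ` ?B"
      then obtain \<eta>' where "\<eta>' \<in> ?B" "R \<eta> = R \<eta>'" by (rule imageE)
      then show "\<eta> \<in> ?B" using R'R[OF \<eta>] R'R[of \<eta>'] Bext by auto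
    qed simp
    moreover have "map (R \<eta>) [1..<card D - 1] = map \<eta> (map (part_time D) [1..<card D - 1])"
      by (simp add: R_def I_def inner_index_def)
    ultimately show ?thesis
      unfolding f_def img map_part_time[OF D] J_def by (simp add: indicator_def)
  qed
  \<comment> \<open>Both integrability and the value of the integral are obtained by rewriting the
    rank-indexed measure as this push-forward.\<close>
  have distr: "?PI = distr ?PJ ?PI R"
    unfolding R_def by (rule distr_PiM_reindex_finite[OF sigma_finite finJ bij, symmetric])
  have int: "integrable ?PJ (\<lambda>\<eta>. f (R \<eta>))"
    using integrable_cylinder[OF finJ Bs, of x y] fR by (simp cong: Bochner_Integration.integrable_cong)
  then show "integrable (part_product \<mu> D) f"
    unfolding prod by (subst distr) (simp add: integrable_distr_eq[OF R_meas f_meas])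
  have "integral\<^sup>L ?PI f = (LINT \<eta>|?PJ. f (R \<eta>))"
    by (subst distr) (rule integral_distr[OF R_meas f_meas])
  also have "\<dots> = cylinder_integral x y J ?B"
    unfolding cylinder_integral_def by (intro Bochner_Integration.integral_cong refl fR)
  finally show "integral\<^sup>L (part_product \<mu> D) f = cylinder_integral x y (D - {0, 1}) (cyl_base D A)"
    unfolding prod J_def .
qed

end

lemma (in scalar_coordinate) hom_chain:
  assumes "\<And>x y. \<Omega> x y \<in> fibre_hom L x y"
  shows "hom_chain L \<Omega> x zs y \<in> fibre_hom L x y \<and>
    coeff x (hom_chain L \<Omega> x zs y) = scalar_chain (\<lambda>x y. coeff x (\<Omega> x y)) x zs y"
proof (induction zs arbitrary: x)
  case (Cons z zs)
  show ?case using hom_mult[OF assms Cons[THEN conjunct1]] Cons by simp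
qed (simp add: assms)

section \<open>The universal property and consistency under refinement\<close>

lemma measurable_path_cyl_eval:
  assumes t: "t \<in> D" and D: "D \<in> time_partitions"
  shows "(\<lambda>\<gamma>. \<gamma> t) \<in> borel_measurable (path_cyl x y D)"
proof (rule measurableI)
  fix S :: "'a set" assume S: "S \<in> sets borel"
  have t01: "t \<in> {0..1}" using t D by (auto simp: time_partitions_def)
  let ?A = "(\<lambda>\<gamma>. \<gamma> t) -` S \<inter> path_space x y"
  have "?A \<in> sets (path_borel x y)"
    using measurable_sets[OF measurable_path_eval[OF t01] S, of x y] by (simp add: space_path_borel)
  moreover have "\<gamma>\<^sub>2 \<in> ?A" if "\<gamma>\<^sub>2 \<in> path_space x y" "\<gamma>\<^sub>1 \<in> ?A" "restrict \<gamma>\<^sub>1 D = restrict \<gamma>\<^sub>2 D" for \<gamma>\<^sub>1 \<gamma>\<^sub>2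
    using fun_cong[OF that(3), of t] that(1,2) t by simp
  ultimately have "?A \<in> path_cyl_sets x y D" unfolding path_cyl_sets_def by blast
  then show "(\<lambda>\<gamma>. \<gamma> t) -` S \<inter> space (path_cyl x y D) \<in> sets (path_cyl x y D)"
    by (simp add: space_path_cyl sets_path_cyl)
qed simp

text \<open>Since the transition maps are identities and \<open>{0, 1}\<close> is the least
  partition, a cone is a single map seen through different \<open>\<sigma>\<close>-algebras. Its
  evaluation at a time \<open>t\<close> is measurable because of the member of the cone at
  \<open>{0, 1, t}\<close>.\<close>

lemma path_borel_measurable_limit:
  fixes x y :: "'m::{t2_space, second_countable_topology}"
  assumes "locally_euclidean TYPE('m)"
  shows "is_measurable_limit TYPE('z) time_partitions (\<subseteq>) (path_cyl x y) (\<lambda>_ _. id) (path_borel x y) (\<lambda>_. id)"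
  unfolding is_measurable_limit_def
proof (intro conjI allI impI)
  have "id \<in> measurable (path_borel x y) (path_cyl x y D)" for D
  proof (rule measurableI)
    fix A assume "A \<in> sets (path_cyl x y D)"
    then have "A \<in> sets (path_borel x y)" by (simp add: sets_path_cyl path_cyl_sets_def)
    then show "id -` A \<inter> space (path_borel x y) \<in> sets (path_borel x y)" by simp
  qed (simp add: space_path_borel space_path_cyl)
  then show "measurable_cone time_partitions (\<subseteq>) (path_cyl x y) (\<lambda>_ _. id) (path_borel x y) (\<lambda>_. id)"
    by (simp add: measurable_cone_def)
next
  fix Z :: "'z measure" and g
  assume "measurable_cone time_partitions (\<subseteq>) (path_cyl x y) (\<lambda>_ _. id) Z g"
  then have g: "\<And>D. D \<in> time_partitions \<Longrightarrow> g D \<in> measurable Z (path_cyl x y D)"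
    and cone: "\<And>D D' z. D \<in> time_partitions \<Longrightarrow> D' \<in> time_partitions \<Longrightarrow> D \<subseteq> D' \<Longrightarrow> z \<in> space Z \<Longrightarrow> g D' z = g D z"
    unfolding measurable_cone_def id_apply by blast+
  let ?h = "restrict (g {0, 1}) (space Z)"
  have D0: "{0, 1} \<in> time_partitions" by (auto simp: time_partitions_def)
  have h: "g D z = g {0, 1} z" if "D \<in> time_partitions" "z \<in> space Z" for D z
    using cone[OF D0 that(1) _ that(2)] that(1) by (auto simp: time_partitions_def)
  have "?h \<in> measurable Z (path_borel x y)"
  proof (rule measurable_into_path_borel[OF locally_euclidean_imp_regular[OF assms]])
    show "?h \<in> space Z \<rightarrow> path_space x y"
      using measurable_space[OF g[OF D0]] by (simp add: space_path_cyl)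
    fix t :: real assume t: "t \<in> {0..1}"
    then have D: "{0, 1, t} \<in> time_partitions" by (auto simp: time_partitions_def)
    have "(\<lambda>z. g {0, 1, t} z t) \<in> borel_measurable Z"
      by (rule measurable_compose[OF g[OF D] measurable_path_cyl_eval[OF _ D]]) simp
    then show "(\<lambda>z. ?h z t) \<in> borel_measurable Z"
      by (rule measurable_cong[THEN iffD1, rotated]) (simp add: h[OF D])
  qed
  then show "\<exists>!h. h \<in> measurable Z (path_borel x y) \<inter> extensional (space Z) \<and>
      (\<forall>D\<in>time_partitions. \<forall>z\<in>space Z. id (h z) = g D z)"
  proof (intro ex1I[of _ ?h] conjI IntI)
    show "\<forall>D\<in>time_partitions. \<forall>z\<in>space Z. id (?h z) = g D z" by (simp add: h)
    fix h assume "h \<in> measurable Z (path_borel x y) \<inter> extensional (space Z) \<and>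
      (\<forall>D\<in>time_partitions. \<forall>z\<in>space Z. id (h z) = g D z)"
    then show "h = ?h" using D0 by (intro extensionalityI[of h "space Z"]) auto
  qed simp_all
qed

text \<open>Two nested finite partitions differ by finitely many times, so induction on the
  difference reduces the claim to \<open>cylinder_integral_insert\<close>. At each step
  \<open>A\<close> remains a cylinder set for the enlarged partition.\<close>

lemma cylinder_integral_refine:
  fixes x y :: "'m::{t2_space, second_countable_topology}"
  assumes M: "locally_euclidean TYPE('m)" "connected (UNIV :: 'm set)" and sp: "scalar_propagator \<mu> w C"
    and A: "A \<in> path_cyl_sets x y D" and D: "D \<in> time_partitions" "D' \<in> time_partitions" "D \<subseteq> D'"
  shows "scalar_propagator.cylinder_integral \<mu> w x y (D' - {0, 1}) (cyl_base D' A) =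
    scalar_propagator.cylinder_integral \<mu> w x y (D - {0, 1}) (cyl_base D A)"
proof -
  interpret scalar_propagator \<mu> w C by (rule sp)
  have "cylinder_integral x y ((D \<union> F) - {0, 1}) (cyl_base (D \<union> F) A) =
      cylinder_integral x y (D - {0, 1}) (cyl_base D A)"
    if "finite F" "F \<inter> D = {}" "F \<subseteq> {0..1}" for F
    using that
  proof (induction F rule: finite_induct)
    case (insert t F)
    let ?E = "D \<union> F"
    have E: "?E \<in> time_partitions" "insert t ?E \<in> time_partitions"
      using D(1) insert by (auto simp: time_partitions_def)
    \<comment> \<open>A new time differs from 0 and 1 since these already belong to
      \<open>D\<close>; it therefore adds exactly one integration variable.\<close>
    have t: "t \<notin> {0, 1}" using D(1) insert.prems by (auto simp: time_partitions_def)
    then have ins: "insert t ?E - {0, 1} = insert t (?E - {0, 1})" by auto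
    have AE: "A \<in> path_cyl_sets x y ?E" "A \<in> path_cyl_sets x y (insert t ?E)"
      using A path_cyl_sets_mono[of D ?E x y] path_cyl_sets_mono[of D "insert t ?E" x y] by auto
    have "cylinder_integral x y (insert t (?E - {0, 1})) (cyl_base (insert t ?E) A) =
        cylinder_integral x y (?E - {0, 1}) (cyl_base ?E A)"
    proof (rule cylinder_integral_insert)
      show "finite (?E - {0, 1})" using E(1) by (simp add: time_partitions_def)
      show "t \<notin> ?E - {0, 1}" using insert by auto
      show "cyl_base (insert t ?E) A \<in> sets (Pi\<^sub>M (insert t (?E - {0, 1})) (\<lambda>_. \<mu>))"
        using cyl_base_measurable[OF M AE(2) E(2)] unfolding ins sets_PiM_\<mu> .
      show "\<eta> \<in> cyl_base (insert t ?E) A \<longleftrightarrow> restrict \<eta> (?E - {0, 1}) \<in> cyl_base ?E A"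
        if "\<eta> \<in> extensional (insert t (?E - {0, 1}))" for \<eta>
        using cyl_base_refine[OF M AE(1) E, of \<eta>] that unfolding ins by blast
    qed
    then show ?case using insert ins by simp
  qed simp
  from this[of "D' - D"] D show ?thesis
    by (auto simp: time_partitions_def Un_absorb1)
qed

text \<open>As \<open>path_measure\<close> is defined by \<open>THE\<close>, the first conjunct
  certifies that it is an actual integral over a measurable image and not an unspecified
  value.\<close>

theorem proposition6p1p4:
  fixes L :: "('m::{t2_space, second_countable_topology}, 'l::topological_space) line_bundle"
    and \<mu> :: "'m measure"
    and \<Omega> :: "'m \<Rightarrow> 'm \<Rightarrow> 'l \<Rightarrow> 'l"
    and x y :: 'm
  assumes "locally_euclidean TYPE('m)"
    and "connected (UNIV :: 'm set)"
    and "sets \<mu> = sets borel"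
    and "hermitian_line_bundle L"
    and "propagator L \<mu> \<Omega>"
  shows "(\<forall>D\<in>time_partitions. \<forall>A\<in>sets (path_cyl x y D).
            has_hom_integral L x y (part_product \<mu> D) (part_eval D ` A)
              (part_amplitude L \<Omega> x y D) (path_measure L \<mu> \<Omega> x y D A)) \<and>
         hom_measure_inverse_system L x y time_partitions (\<subseteq>)
           (path_cyl x y) (path_measure L \<mu> \<Omega> x y) (\<lambda>_ _. id) \<and>
         is_measurable_limit TYPE('z) time_partitions (\<subseteq>)
           (path_cyl x y) (\<lambda>_ _. id) (path_borel x y) (\<lambda>_. id)"
proof -
  note M = assms(1) assms(2)
  have cont: "continuous_hom_section L \<Omega>" using assms(5) by (simp add: propagator_def)
  then have hom: "\<Omega> x y \<in> fibre_hom L x y" for x y by (simp add: continuous_hom_section_def)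
  obtain \<kappa> where sc: "scalar_coordinate L \<kappa>"
    and meas: "(\<lambda>(x, y). scalar_coordinate.coeff L \<kappa> x (\<Omega> x y)) \<in> borel_measurable borel"
    by (rule hermitian_scalar_coordinate[OF assms(4)]) (use cont in blast)
  interpret scalar_coordinate L \<kappa> by (rule sc)
  let ?w = "\<lambda>x y. coeff x (\<Omega> x y)"
  obtain C where sp: "scalar_propagator \<mu> ?w C"
    using scalar_propagator_coeff[OF assms(4) sc assms(5) meas assms(3)] ..
  interpret S: scalar_propagator \<mu> ?w C by (rule sp)
  let ?m = "path_measure L \<mu> \<Omega> x y"
  have amp: "part_amplitude L \<Omega> x y D \<xi> \<in> fibre_hom L x y"
    "coeff x (part_amplitude L \<Omega> x y D \<xi>) = scalar_chain ?w x (map \<xi> [1..<card D - 1]) y" for D \<xi>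
    unfolding part_amplitude_def
    by (rule hom_chain[OF hom, THEN conjunct1], rule hom_chain[OF hom, THEN conjunct2])
  have main: "has_hom_integral L x y (part_product \<mu> D) (part_eval D ` A) (part_amplitude L \<Omega> x y D) (?m D A)"
    and coeff_m: "coeff x (?m D A) = S.cylinder_integral x y (D - {0, 1}) (cyl_base D A)"
    if D: "D \<in> time_partitions" and A: "A \<in> path_cyl_sets x y D" for D A
  proof -
    note B = cyl_base_measurable[OF M A D]
    note part = S.part_eval_image_integral(1)[OF D B] S.part_eval_image_integral(2,3)[OF D B, of x y]
    show "has_hom_integral L x y (part_product \<mu> D) (part_eval D ` A) (part_amplitude L \<Omega> x y D) (?m D A)"
      unfolding path_measure_def by (rule hom_integral(1)[OF part(1) amp(1)]) (simp only: amp(2) part(2))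
    have "coeff x (?m D A) = (LINT \<xi>|part_product \<mu> D. indicator (part_eval D ` A) \<xi> *\<^sub>R coeff x (part_amplitude L \<Omega> x y D \<xi>))"
      unfolding path_measure_def by (rule hom_integral(2)[OF part(1) amp(1)]) (simp only: amp(2) part(2))
    then show "coeff x (?m D A) = S.cylinder_integral x y (D - {0, 1}) (cyl_base D A)"
      by (simp only: amp(2) part(3))
  qed
  have m_hom: "?m D A \<in> fibre_hom L x y" if "D \<in> time_partitions" "A \<in> path_cyl_sets x y D" for D A
    using main[OF that] by (simp add: has_hom_integral_def)
  have refine: "?m D' A = ?m D A"
    if D: "D \<in> time_partitions" "D' \<in> time_partitions" "D \<subseteq> D'" and A: "A \<in> path_cyl_sets x y D" for D D' A
  proof -
    have A': "A \<in> path_cyl_sets x y D'" using A path_cyl_sets_mono[OF D(3)] by blast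
    show ?thesis
      by (rule hom_eqI[OF m_hom[OF D(2) A'] m_hom[OF D(1) A]])
        (simp add: coeff_m[OF D(2) A'] coeff_m[OF D(1) A] cylinder_integral_refine[OF M sp A D])
  qed
  have add: "(\<lambda>i. coeff x (?m D (A i))) sums coeff x (?m D (\<Union>i. A i))"
    if D: "D \<in> time_partitions" and A: "range A \<subseteq> path_cyl_sets x y D" and disj: "disjoint_family A" for D and A :: "nat \<Rightarrow> _"
  proof -
    have Ai: "A i \<in> path_cyl_sets x y D" for i using A by blast
    have U: "(\<Union>i. A i) \<in> path_cyl_sets x y D"
      using sets.countable_UN[of A UNIV "path_cyl x y D"] A by (simp add: sets_path_cyl)
    have "(\<lambda>i. S.cylinder_integral x y (D - {0, 1}) (cyl_base D (A i))) sums
        S.cylinder_integral x y (D - {0, 1}) (\<Union>i. cyl_base D (A i))"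
    proof (rule S.cylinder_integral_sums)
      show "finite (D - {0, 1})" using D by (simp add: time_partitions_def)
      show "cyl_base D (A i) \<in> sets (Pi\<^sub>M (D - {0, 1}) (\<lambda>_. \<mu>))" for i
        using cyl_base_measurable[OF M Ai D] unfolding S.sets_PiM_\<mu> .
      show "disjoint_family (\<lambda>i. cyl_base D (A i))"
        unfolding disjoint_family_on_def
        using cyl_base_disjoint[OF M Ai Ai D] disj by (simp add: disjoint_family_on_def)
    qed
    then show ?thesis
      unfolding coeff_m[OF D Ai] coeff_m[OF D U] by (simp add: cyl_base_def image_UN)
  qed
  have measure: "hom_measure L x y (path_cyl x y D) (?m D)" if D: "D \<in> time_partitions" for D
    unfolding hom_measure_def
  proof (intro conjI ballI)
    fix A assume "A \<in> sets (path_cyl x y D)"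
    then show "?m D A \<in> fibre_hom L x y" using m_hom[OF D] by (simp add: sets_path_cyl)
  next
    fix u v assume u: "u \<in> fibre L x" and v: "v \<in> fibre L y"
    \<comment> \<open>For fixed \<open>u\<close> and \<open>v\<close> the coordinate is a constant
      multiple of the coefficient, so countable additivity carries over from
      \<open>add\<close>.\<close>
    have eq: "bherm L (?m D A u) v = coeff x (?m D A) * (\<kappa> u * cnj (\<kappa> v))" if "A \<in> path_cyl_sets x y D" for A
      using herm[OF hom_in_fibre[OF m_hom[OF D that] u] v] coeff[OF m_hom[OF D that] u] by simp
    show "complex_measure (path_cyl x y D) (\<lambda>A. bherm L (?m D A u) v)"
      unfolding complex_measure_def
    proof (intro conjI allI impI)
      have e: "{} \<in> path_cyl_sets x y D" by (simp add: path_cyl_sets_def)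
      show "bherm L (?m D {} u) v = 0"
        unfolding eq[OF e] coeff_m[OF D e] by (simp add: S.cylinder_integral_def cyl_base_def)
      fix A :: "nat \<Rightarrow> _" assume A: "range A \<subseteq> sets (path_cyl x y D)" and disj: "disjoint_family A"
      have Ai: "A i \<in> path_cyl_sets x y D" for i using A by (auto simp: sets_path_cyl)
      have U: "(\<Union>i. A i) \<in> path_cyl_sets x y D"
        using sets.countable_UN[of A UNIV "path_cyl x y D"] A by (simp add: sets_path_cyl)
      show "(\<lambda>i. bherm L (?m D (A i) u) v) sums bherm L (?m D (\<Union>i. A i) u) v"
        unfolding eq[OF Ai] eq[OF U] using A by (intro sums_mult2 add D disj) (simp add: sets_path_cyl)
    qed
  qed
  have "directed_index time_partitions (\<subseteq>)"
    unfolding directed_index_def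
  proof (intro conjI ballI impI)
    have "{0, 1} \<in> time_partitions" by (auto simp: time_partitions_def)
    then show "time_partitions \<noteq> {}" by blast
    fix D E assume "D \<in> time_partitions" "E \<in> time_partitions"
    then show "\<exists>F\<in>time_partitions. D \<subseteq> F \<and> E \<subseteq> F"
      by (intro bexI[of _ "D \<union> E"]) (auto simp: time_partitions_def)
  qed auto
  moreover have "measure_morphism (path_cyl x y D') (?m D') (path_cyl x y D) (?m D) id"
    if D: "D \<in> time_partitions" "D' \<in> time_partitions" "D \<subseteq> D'" for D D'
  proof -
    have pre: "id -` A \<inter> space (path_cyl x y D') = A" if "A \<in> path_cyl_sets x y D" for A
      using path_cyl_sets_subset[OF that] by (auto simp: space_path_cyl)
    show ?thesis
      unfolding measure_morphism_def
    proof (intro conjI ballI measurableI)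
      fix A assume A: "A \<in> sets (path_cyl x y D)"
      then have A: "A \<in> path_cyl_sets x y D" by (simp add: sets_path_cyl)
      show "id -` A \<inter> space (path_cyl x y D') \<in> sets (path_cyl x y D')"
        unfolding pre[OF A] using A path_cyl_sets_mono[OF D(3)] by (auto simp: sets_path_cyl)
      show "?m D' (id -` A \<inter> space (path_cyl x y D')) = ?m D A"
        unfolding pre[OF A] by (rule refine[OF D A])
    qed (simp add: space_path_cyl)
  qed
  ultimately have "hom_measure_inverse_system L x y time_partitions (\<subseteq>) (path_cyl x y) ?m (\<lambda>_ _. id)"
    unfolding hom_measure_inverse_system_def using measure by simp
  then show ?thesis
    unfolding sets_path_cyl by (intro conjI ballI main path_borel_measurable_limit[OF M(1)])
qed

end
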